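(* Let $n\in\mathbb{N}$, let $r\ge 2$ ($r=\infty$ and $r=\omega$ allowed), and let $f=(Q,P):\mathbb{R}^n\times\mathbb{R}^n\to\mathbb{R}^n\times\mathbb{R}^n$, $(q,p)\mapsto(Q(q,p),P(q,p))$, be a $C^r$ diffeomorphism that is symplectic, i.e., preserves $\Omega=\sum_{j=1}^n \mathrm{d}p_j\wedge\mathrm{d}q_j$. Suppose that $f$ is $C^r$ integrable as a symplectic diffeomorphism, with first integrals $F_1,\dots,F_n$. Then $f$ is locally $C^{r-1}$ $(n,n)$-integrable near any point $(q,p)$ at which the derivatives $\mathrm{D}F_1,\dots,\mathrm{D}F_n$ of the first integrals are linearly independent.
   Context: Definition (integrability of symplectic diffeomorphisms). The symplectic diffeomorphism $f=(Q,P)$ is $C^r$ integrable if there exist $n$ scalar-valued $C^r$ functions $F_1,\dots,F_n$ of $(q,p)$ which are first integrals of $f$ (i.e., $F_j\circ f=F_j$), whose derivatives $\mathrm{D}F_j(q,p)$, $j=1,\dots,n$, are linearly independent almost everywhere, and which are in involution: $$\{F_j,F_k\}:=\mathrm{D}_qF_j^{T}\,\mathrm{D}_pF_k-\mathrm{D}_pF_j^{T}\,\mathrm{D}_qF_k\equiv 0,\quad j,k=1,\dots,n.$$ Definition (integrability of general diffeomorphisms). A diffeomorphism $f$ of an $N$-dimensional manifold is $(m,N-m)$-integrable if there exist $m$ vector fields $X_1,\ldots,X_m$ and $N-m$ scalar-valued functions $F_1,\ldots,F_{N-m}$ such that: (i) $X_1,\dots,X_m$ are linearly independent almost everywhere and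 commute with each other (vanishing Lie brackets); (ii) $\mathrm{d}F_1,\ldots,\mathrm{d}F_{N-m}$ are linearly independent almost everywhere and $F_1,\ldots,F_{N-m}$ are first integrals of $X_1,\dots,X_m$, i.e., $\mathrm{d}F_k(X_j)\equiv 0$; (iii) the flow $\varphi_j^t$ of each $X_j$ commutes with $f$, $f\circ\varphi_j^t=\varphi_j^t\circ f$, and $F_j\circ f=F_j$ for each $j$. It is $C^s$ integrable if the first integrals, the commutative vector fields and $f$ are $C^s$. Here $N=2n$ and $m=n$. "Locally $C^{r-1}$ $(n,n)$-integrable near a point" means that there is an open neighborhood $U$ of the point and vector fields and functions of class $C^{r-1}$ defined on $U$ satisfying (i) and (ii) on $U$ and satisfying (iii) wherever both sides are defined within $U$: that is, $F_j(f(x))=F_j(x)$ whenever $x,f(x)\in U$, and $f(\varphi_j^t(x))=\varphi_j^t(f(x))$ whenever $x,f(x)\in U$ and the local flow lines $\varphi_j^s(x)$ and $\varphi_j^s(f(x))$ exist in $U$ for all $s$ between $0$ and $t$. Conventions: $r-1=\infty$ if $r=\infty$ and $r-1=\omega$ if $r=\omega$ (analytic). *)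

theory Defs
  imports "HOL-Analysis.Analysis"
begin

datatype regularity = Finite_Order nat | Infinite_Order | Real_Analytic

primrec cont_diff_on :: "nat \<Rightarrow> ('a::real_normed_vector \<Rightarrow> 'b::real_normed_vector) \<Rightarrow> 'a set \<Rightarrow> bool"
  where
    "cont_diff_on 0 f U \<longleftrightarrow> continuous_on U f"
  | "cont_diff_on (Suc k) f U \<longleftrightarrow>
       (\<forall>x\<in>U. f differentiable (at x)) \<and>
       (\<forall>v. cont_diff_on k (\<lambda>x. frechet_derivative f (at x) v) U)"

text \<open>Near every point of \<open>U\<close> the function is the sum of an absolutely convergent power series
  \<open>\<Sum>\<^sub>\<alpha> (y - x)\<^sup>\<alpha> c\<^sub>\<alpha>\<close>; the multi-indices \<open>\<alpha>\<close> are the extensional functions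
  from the standard basis to the naturals.\<close>

definition real_analytic_on :: "('a::euclidean_space \<Rightarrow> 'b::euclidean_space) \<Rightarrow> 'a set \<Rightarrow> bool"
  where
    "real_analytic_on f U \<longleftrightarrow>
       (\<forall>x\<in>U. \<exists>e>0. \<exists>c. \<forall>y\<in>ball x e.
          ((\<lambda>\<alpha>. (\<Prod>b\<in>Basis. ((y - x) \<bullet> b) ^ \<alpha> b) *\<^sub>R c \<alpha>) has_sum f y)
            (Basis \<rightarrow>\<^sub>E (UNIV :: nat set)))"

text \<open>\<open>class_C_on r f U\<close> is used for open \<open>U\<close> only: the derivatives involved are taken in the whole
  space.\<close>

fun class_C_on :: "regularity \<Rightarrow> ('a::euclidean_space \<Rightarrow> 'b::euclidean_space) \<Rightarrow> 'a set \<Rightarrow> bool"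
  where
    "class_C_on (Finite_Order k) f U \<longleftrightarrow> cont_diff_on k f U"
  | "class_C_on Infinite_Order f U \<longleftrightarrow> (\<forall>k. cont_diff_on k f U)"
  | "class_C_on Real_Analytic f U \<longleftrightarrow> real_analytic_on f U"

fun at_least_order :: "nat \<Rightarrow> regularity \<Rightarrow> bool"
  where
    "at_least_order m (Finite_Order k) \<longleftrightarrow> m \<le> k"
  | "at_least_order m Infinite_Order \<longleftrightarrow> True"
  | "at_least_order m Real_Analytic \<longleftrightarrow> True"

fun pred_regularity :: "regularity \<Rightarrow> regularity"
  where
    "pred_regularity (Finite_Order k) = Finite_Order (k - 1)"
  | "pred_regularity Infinite_Order = Infinite_Order"
  | "pred_regularity Real_Analytic = Real_Analytic"

definition C_diffeomorphism :: "regularity \<Rightarrow> ('a::euclidean_space \<Rightarrow> 'a) \<Rightarrow> bool"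
  where
    "C_diffeomorphism r f \<longleftrightarrow> bij f \<and> class_C_on r f UNIV \<and> class_C_on r (inv f) UNIV"

definition independent_family :: "nat \<Rightarrow> (nat \<Rightarrow> 'a::real_vector) \<Rightarrow> bool"
  where "independent_family m v \<longleftrightarrow> inj_on v {..<m} \<and> independent (v ` {..<m})"

text \<open>The derivative as an element of the dual space; meaningful where \<open>F\<close> is differentiable.\<close>

definition differential :: "('a::euclidean_space \<Rightarrow> real) \<Rightarrow> 'a \<Rightarrow> 'a \<Rightarrow>\<^sub>L real"
  where "differential F x = Blinfun (frechet_derivative F (at x))"

text \<open>Points of the phase space are pairs \<open>(q, p)\<close>; the form is \<open>\<Sum>\<^sub>j dp\<^sub>j \<and> dq\<^sub>j\<close>.\<close>

definition Omega :: "(real^'n) \<times> (real^'n) \<Rightarrow> (real^'n) \<times> (real^'n) \<Rightarrow> real"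
  where "Omega u v = (\<Sum>j\<in>UNIV. snd u $ j * fst v $ j - fst u $ j * snd v $ j)"

definition symplectic :: "((real^'n) \<times> (real^'n) \<Rightarrow> (real^'n) \<times> (real^'n)) \<Rightarrow> bool"
  where
    "symplectic f \<longleftrightarrow>
       (\<forall>x u v. Omega (frechet_derivative f (at x) u) (frechet_derivative f (at x) v) = Omega u v)"

definition poisson_bracket ::
  "((real^'n) \<times> (real^'n) \<Rightarrow> real) \<Rightarrow> ((real^'n) \<times> (real^'n) \<Rightarrow> real) \<Rightarrow> (real^'n) \<times> (real^'n) \<Rightarrow> real"
  where
    "poisson_bracket F G x =
       (\<Sum>i\<in>UNIV. frechet_derivative F (at x) (axis i 1, 0) * frechet_derivative G (at x) (0, axis i 1)
               - frechet_derivative F (at x) (0, axis i 1) * frechet_derivative G (at x) (axis i 1, 0))"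

definition symplectically_integrable_with ::
  "regularity \<Rightarrow> ((real^'n) \<times> (real^'n) \<Rightarrow> (real^'n) \<times> (real^'n)) \<Rightarrow>
     (nat \<Rightarrow> (real^'n) \<times> (real^'n) \<Rightarrow> real) \<Rightarrow> bool"
  where
    "symplectically_integrable_with r f F \<longleftrightarrow>
       (\<forall>j<CARD('n). class_C_on r (F j) UNIV) \<and>
       (\<forall>j<CARD('n). F j \<circ> f = F j) \<and>
       (AE x in lborel. independent_family CARD('n) (\<lambda>j. differential (F j) x)) \<and>
       (\<forall>j<CARD('n). \<forall>k<CARD('n). \<forall>x. poisson_bracket (F j) (F k) x = 0)"

definition lie_bracket :: "('a::euclidean_space \<Rightarrow> 'a) \<Rightarrow> ('a \<Rightarrow> 'a) \<Rightarrow> 'a \<Rightarrow> 'a"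
  where
    "lie_bracket X Y x = frechet_derivative Y (at x) (X x) - frechet_derivative X (at x) (Y x)"

text \<open>The graph of the local flow \<open>\<phi>\<^sup>t\<close> of \<open>X\<close> in \<open>U\<close>: the flow line of \<open>x\<close> exists in \<open>U\<close> for all
  times between \<open>0\<close> and \<open>t\<close> (which may be negative) and satisfies \<open>\<phi>\<^sup>t(x) = y\<close>.
  For \<open>X\<close> of class \<open>C\<^sup>1\<close> such a \<open>y\<close> is unique.\<close>

definition local_flow ::
  "('a::euclidean_space \<Rightarrow> 'a) \<Rightarrow> 'a set \<Rightarrow> real \<Rightarrow> 'a \<Rightarrow> 'a \<Rightarrow> bool"
  where
    "local_flow X U t x y \<longleftrightarrow>
       (\<exists>\<gamma>. \<gamma> 0 = x \<and> \<gamma> t = y \<and>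
          (\<forall>s\<in>closed_segment 0 t.
             \<gamma> s \<in> U \<and> (\<gamma> has_vector_derivative X (\<gamma> s)) (at s within closed_segment 0 t)))"

text \<open>The witnesses of \<open>(m, N - m)\<close>-integrability of class \<open>C\<^sup>s\<close> of \<open>f\<close> on \<open>U\<close>, where
  \<open>N = DIM('a)\<close>.\<close>

definition integrable_on_with ::
  "regularity \<Rightarrow> nat \<Rightarrow> ('a::euclidean_space \<Rightarrow> 'a) \<Rightarrow> 'a set \<Rightarrow>
     (nat \<Rightarrow> 'a \<Rightarrow> 'a) \<Rightarrow> (nat \<Rightarrow> 'a \<Rightarrow> real) \<Rightarrow> bool"
  where
    "integrable_on_with s m f U X F \<longleftrightarrow>
       (\<forall>j<m. class_C_on s (X j) U) \<and>
       (\<forall>k<DIM('a) - m. class_C_on s (F k) U) \<and>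
       (AE x in lborel. x \<in> U \<longrightarrow> independent_family m (\<lambda>j. X j x)) \<and>
       (\<forall>i<m. \<forall>j<m. \<forall>x\<in>U. lie_bracket (X i) (X j) x = 0) \<and>
       (AE x in lborel. x \<in> U \<longrightarrow> independent_family (DIM('a) - m) (\<lambda>k. differential (F k) x)) \<and>
       (\<forall>k<DIM('a) - m. \<forall>j<m. \<forall>x\<in>U. blinfun_apply (differential (F k) x) (X j x) = 0) \<and>
       (\<forall>j<m. \<forall>t x y z. x \<in> U \<and> f x \<in> U \<and> local_flow (X j) U t x y \<and> local_flow (X j) U t (f x) z
            \<longrightarrow> f y = z) \<and>
       (\<forall>k<DIM('a) - m. \<forall>x. x \<in> U \<and> f x \<in> U \<longrightarrow> F k (f x) = F k x)"

definition locally_integrable_near ::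
  "regularity \<Rightarrow> nat \<Rightarrow> ('a::euclidean_space \<Rightarrow> 'a) \<Rightarrow> 'a \<Rightarrow> bool"
  where
    "locally_integrable_near s m f x0 \<longleftrightarrow>
       m \<le> DIM('a) \<and> C_diffeomorphism s f \<and>
       (\<exists>U X F. open U \<and> x0 \<in> U \<and> integrable_on_with s m f U X F)"

end

theory Submission
  imports Defs
begin

text \<open>The Hamiltonian vector fields \<open>X\<^sub>j\<close> of the first integrals \<open>F\<^sub>j\<close>, characterised by
  \<open>Omega (X\<^sub>j) v = DF\<^sub>j v\<close>, are witnesses on the whole phase space. Involution makes them commute
  and tangent to the level sets of the \<open>F\<^sub>k\<close>; passing to \<open>X\<^sub>j\<close> costs one derivative. Since \<open>f\<close> is symplectic
  and \<open>F\<^sub>j \<circ> f = F\<^sub>j\<close>, nondegeneracy of \<open>Omega\<close> gives \<open>Df X\<^sub>j = X\<^sub>j \<circ> f\<close>, so \<open>f\<close> maps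
  integral curves of \<open>X\<^sub>j\<close> to integral curves, and uniqueness of integral curves shows that \<open>f\<close>
  commutes with the flows.\<close>

section \<open>Iterated differentiability\<close>

text \<open>The bound r \<ge> 2 leaves fields that may be only C^1. This suffices twice: commutation
  rests on the symmetry of the second derivative of a C^2 function, and uniqueness of integral
  curves rests on a Lipschitz bound on compact convex sets. Analyticity is the costly case. It is
  defined by unordered sums over multi-indices, so the loss-free passage from \<open>F\<close> to
  its Hamiltonian field requires termwise differentiation of power series in several variables, with
  the derivative again presented as such a series. No existence theorem for flows enters, since
  \<open>local_flow\<close> is a relation and the commutation condition only compares two given
  curves. The image of a curve in \<open>U\<close> under \<open>f\<close> may leave
  \<open>U\<close>, hence uniqueness is stated for curves lying in possibly different sets.\<close>

lemma has_derivative_frechet_derivative: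
  "f differentiable at x \<Longrightarrow> (f has_derivative frechet_derivative f (at x)) (at x)"
  by (simp add: frechet_derivative_works)

lemma differentiable_cong_open:
  assumes "open U" "x \<in> U" "\<And>y. y \<in> U \<Longrightarrow> f y = g y" "f differentiable at x"
  shows "g differentiable at x"
proof -
  obtain D where "(f has_derivative D) (at x)"
    using assms(4) unfolding differentiable_def by blast
  then have "(g has_derivative D) (at x)"
    by (rule has_derivative_transform_within_open[OF _ assms(1,2)]) (use assms(3) in simp)
  then show ?thesis unfolding differentiable_def by blast
qed

text \<open>On an open set the derivatives at a point depend only on the values in the set. This
  lets the inductions below replace the derivative of a compound function by its explicit formula,
  which is known only on \<open>U\<close>.\<close>

lemma cont_diff_on_cong:
  assumes "open U" "\<And>y. y \<in> U \<Longrightarrow> f y = g y" "cont_diff_on k f U"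
  shows "cont_diff_on k g U"
  using assms(2,3)
proof (induction k arbitrary: f g)
  case 0
  then show ?case using continuous_on_cong[OF refl, of U f g] by simp
next
  case (Suc k)
  have "cont_diff_on k (\<lambda>x. frechet_derivative g (at x) v) U" for v
  proof (rule Suc.IH)
    show "cont_diff_on k (\<lambda>x. frechet_derivative f (at x) v) U"
      using Suc.prems by simp
    show "frechet_derivative f (at y) v = frechet_derivative g (at y) v" if "y \<in> U" for y
      using frechet_derivative_transform_within_open[OF _ assms(1) that Suc.prems(1)] Suc.prems(2) that
      by simp
  qed
  then show ?case
    using Suc.prems differentiable_cong_open[OF assms(1) _ Suc.prems(1)] by simp
qed

lemma cont_diff_on_imp_differentiable:
  "\<lbrakk>cont_diff_on k f U; 1 \<le> k; x \<in> U\<rbrakk> \<Longrightarrow> f differentiable at x"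
  by (cases k) auto

lemma cont_diff_on_imp_continuous_on:
  "cont_diff_on k f U \<Longrightarrow> continuous_on U f"
  by (cases k)
    (auto intro!: differentiable_imp_continuous_on differentiable_at_imp_differentiable_on)

lemma cont_diff_on_Suc_imp:
  "cont_diff_on (Suc k) f U \<Longrightarrow> cont_diff_on k f U"
proof (induction k arbitrary: f)
  case 0
  then show ?case using cont_diff_on_imp_continuous_on[OF 0] by simp
next
  case (Suc k)
  then show ?case by simp
qed

lemma cont_diff_on_mono:
  assumes "cont_diff_on k f U" "m \<le> k"
  shows "cont_diff_on m f U"
  using assms(2,1) by (induction rule: dec_induct) (auto intro: cont_diff_on_Suc_imp simp del: cont_diff_on.simps)

lemma cont_diff_on_add:
  assumes "open U" "cont_diff_on k f U" "cont_diff_on k g U"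
  shows "cont_diff_on k (\<lambda>x. f x + g x) U"
  using assms(2,3)
proof (induction k arbitrary: f g)
  case 0
  then show ?case by (simp add: continuous_on_add)
next
  case (Suc k)
  have "cont_diff_on k (\<lambda>x. frechet_derivative (\<lambda>x. f x + g x) (at x) v) U" for v
  proof (rule cont_diff_on_cong[OF assms(1)])
    show "cont_diff_on k (\<lambda>x. frechet_derivative f (at x) v + frechet_derivative g (at x) v) U"
      using Suc by simp
    show "frechet_derivative f (at y) v + frechet_derivative g (at y) v
        = frechet_derivative (\<lambda>x. f x + g x) (at y) v" if "y \<in> U" for y
    proof -
      have "((\<lambda>x. f x + g x) has_derivative
          (\<lambda>v. frechet_derivative f (at y) v + frechet_derivative g (at y) v)) (at y)"
        using Suc.prems that by (intro has_derivative_add has_derivative_frechet_derivative) auto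
      from frechet_derivative_at[OF this] show ?thesis by metis
    qed
  qed
  then show ?case
    using Suc.prems by (auto intro!: differentiable_add)
qed

lemma cont_diff_on_bounded_linear:
  assumes "open U" "bounded_linear T" "cont_diff_on k f U"
  shows "cont_diff_on k (\<lambda>x. T (f x)) U"
  using assms(3)
proof (induction k arbitrary: f)
  case 0
  then show ?case by (simp add: bounded_linear.continuous_on[OF assms(2)])
next
  case (Suc k)
  have D: "((\<lambda>x. T (f x)) has_derivative (\<lambda>v. T (frechet_derivative f (at y) v))) (at y)"
    if "y \<in> U" for y
    using Suc.prems that
    by (intro bounded_linear.has_derivative[OF assms(2)] has_derivative_frechet_derivative) auto
  have "cont_diff_on k (\<lambda>x. frechet_derivative (\<lambda>x. T (f x)) (at x) v) U" for v
  proof (rule cont_diff_on_cong[OF assms(1)])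
    show "cont_diff_on k (\<lambda>x. T (frechet_derivative f (at x) v)) U"
      using Suc by simp
    show "T (frechet_derivative f (at y) v) = frechet_derivative (\<lambda>x. T (f x)) (at y) v"
      if "y \<in> U" for y
      using frechet_derivative_at[OF D[OF that]] by metis
  qed
  then show ?case
    using D differentiable_def by fastforce
qed

lemma cont_diff_on_zero: "cont_diff_on k (\<lambda>x. 0) U"
  by (induction k) simp_all

text \<open>The left-hand side is symmetric in \<open>u\<close> and \<open>v\<close>, so letting \<open>t\<close> tend to \<open>0\<close> yields the
  symmetry of the second derivative.\<close>

lemma second_difference_mean_value:
  fixes F :: "'a::real_normed_vector \<Rightarrow> real"
  assumes F: "\<And>y. y \<in> U \<Longrightarrow> F differentiable at y"
    and Fu: "\<And>y. y \<in> U \<Longrightarrow> (\<lambda>z. frechet_derivative F (at z) u) differentiable at y"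
    and t: "0 < t" and U: "\<And>a b. \<lbrakk>0 \<le> a; a \<le> t; 0 \<le> b; b \<le> t\<rbrakk> \<Longrightarrow> x + a *\<^sub>R u + b *\<^sub>R v \<in> U"
  shows "\<exists>a b. 0 \<le> a \<and> a \<le> t \<and> 0 \<le> b \<and> b \<le> t \<and>
     F (x + t *\<^sub>R u + t *\<^sub>R v) - F (x + t *\<^sub>R u) - F (x + t *\<^sub>R v) + F x
     = t\<^sup>2 * frechet_derivative (\<lambda>z. frechet_derivative F (at z) u) (at (x + a *\<^sub>R u + b *\<^sub>R v)) v"
proof -
  let ?D = "\<lambda>y. frechet_derivative F (at y)"
  have lin: "frechet_derivative g (at y) (c *\<^sub>R w) = c * frechet_derivative g (at y) w"
    if "g differentiable at y" for g :: "'a \<Rightarrow> real" and y c w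
    using linear_frechet_derivative[OF that] by (simp add: linear_cmul)
  have d1: "((\<lambda>s. F (x + s *\<^sub>R u + b *\<^sub>R v)) has_derivative (\<lambda>h. h * ?D (x + s *\<^sub>R u + b *\<^sub>R v) u)) (at s within {0..t})"
    if "0 \<le> b" "b \<le> t" "0 \<le> s" "s \<le> t" for b s
  proof -
    have "((\<lambda>s. F (x + s *\<^sub>R u + b *\<^sub>R v)) has_derivative
        (\<lambda>h. ?D (x + s *\<^sub>R u + b *\<^sub>R v) (h *\<^sub>R u))) (at s within {0..t})"
      by (rule has_derivative_compose[where f = "\<lambda>s. x + s *\<^sub>R u + b *\<^sub>R v" and g = F])
        (use has_derivative_frechet_derivative[OF F[OF U[OF that(3,4,1,2)]]] in
          \<open>auto intro!: derivative_eq_intros\<close>)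
    then show ?thesis by (simp only: lin[OF F[OF U[OF that(3,4,1,2)]]])
  qed
  \<comment> \<open>The second difference is the increment over \<open>[0, t]\<close> of
    \<open>s\<close> mapped to \<open>F (x + s u + t v) - F (x + s u)\<close>. The summand
    \<open>0 *\<^sub>R v\<close> is kept so that both terms are instances of
    \<open>d1\<close>.\<close>
  have "\<exists>a\<in>{0<..<t}. (F (x + t *\<^sub>R u + t *\<^sub>R v) - F (x + t *\<^sub>R u + 0 *\<^sub>R v)) -
          (F (x + 0 *\<^sub>R u + t *\<^sub>R v) - F (x + 0 *\<^sub>R u + 0 *\<^sub>R v))
      = (\<lambda>h. h * ?D (x + a *\<^sub>R u + t *\<^sub>R v) u - h * ?D (x + a *\<^sub>R u + 0 *\<^sub>R v) u) (t - 0)"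
    by (rule mvt_simple[where f = "\<lambda>s. F (x + s *\<^sub>R u + t *\<^sub>R v) - F (x + s *\<^sub>R u + 0 *\<^sub>R v)"
          and f' = "\<lambda>a h. h * ?D (x + a *\<^sub>R u + t *\<^sub>R v) u - h * ?D (x + a *\<^sub>R u + 0 *\<^sub>R v) u"])
      (use t in \<open>auto intro!: has_derivative_diff d1 simp del: scaleR_zero_left\<close>)
  then obtain a where a: "0 < a" "a < t" and
    A: "F (x + t *\<^sub>R u + t *\<^sub>R v) - F (x + t *\<^sub>R u) - F (x + t *\<^sub>R v) + F x
      = t * (?D (x + a *\<^sub>R u + t *\<^sub>R v) u - ?D (x + a *\<^sub>R u + 0 *\<^sub>R v) u)"
    by (auto simp: algebra_simps)
  let ?G = "\<lambda>z. ?D z u"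
  have d2: "((\<lambda>s. ?G (x + a *\<^sub>R u + s *\<^sub>R v)) has_derivative
      (\<lambda>h. h * frechet_derivative ?G (at (x + a *\<^sub>R u + s *\<^sub>R v)) v)) (at s within {0..t})"
    if "0 \<le> s" "s \<le> t" for s
  proof -
    have "((\<lambda>s. ?G (x + a *\<^sub>R u + s *\<^sub>R v)) has_derivative
        (\<lambda>h. frechet_derivative ?G (at (x + a *\<^sub>R u + s *\<^sub>R v)) (h *\<^sub>R v))) (at s within {0..t})"
      by (rule has_derivative_compose[where f = "\<lambda>s. x + a *\<^sub>R u + s *\<^sub>R v" and g = ?G])
        (use has_derivative_frechet_derivative[OF Fu[OF U[OF _ _ that]]] a in
          \<open>auto intro!: derivative_eq_intros\<close>)
    then show ?thesis using a by (simp only: lin[OF Fu[OF U[OF _ _ that]]] less_imp_le)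
  qed
  obtain b where b: "0 < b" "b < t" and
    B: "?D (x + a *\<^sub>R u + t *\<^sub>R v) u - ?D (x + a *\<^sub>R u + 0 *\<^sub>R v) u
      = t * frechet_derivative ?G (at (x + a *\<^sub>R u + b *\<^sub>R v)) v"
    using mvt_simple[OF t, of "\<lambda>s. ?G (x + a *\<^sub>R u + s *\<^sub>R v)", OF d2] by auto
  show ?thesis
    using a b A B by (intro exI[of _ a] exI[of _ b]) (simp add: power2_eq_square)
qed

lemma second_derivative_symmetric:
  fixes F :: "'a::real_normed_vector \<Rightarrow> real"
  assumes "cont_diff_on 2 F U" "open U" "x \<in> U"
  shows "frechet_derivative (\<lambda>z. frechet_derivative F (at z) u) (at x) v
       = frechet_derivative (\<lambda>z. frechet_derivative F (at z) v) (at x) u"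
proof -
  let ?A = "\<lambda>y. frechet_derivative (\<lambda>z. frechet_derivative F (at z) u) (at y) v"
  let ?B = "\<lambda>y. frechet_derivative (\<lambda>z. frechet_derivative F (at z) v) (at y) u"
  have F: "F differentiable at y" "(\<lambda>z. frechet_derivative F (at z) w) differentiable at y"
    if "y \<in> U" for y w
    using assms(1) that by (auto simp: numeral_2_eq_2)
  have cont: "isCont ?A x" "isCont ?B x"
    using assms by (auto simp: numeral_2_eq_2 continuous_on_eq_continuous_at)
  obtain e where e: "e > 0" "ball x e \<subseteq> U"
    using assms(2,3) open_contains_ball by blast
  have "dist (?A x) (?B x) \<le> \<epsilon>" if eps: "\<epsilon> > 0" for \<epsilon>
  proof -
    obtain d1 where d1: "d1 > 0" "\<forall>y. dist y x < d1 \<longrightarrow> dist (?A y) (?A x) < \<epsilon>/2"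
      using cont(1)[unfolded continuous_at_eps_delta, rule_format, OF half_gt_zero[OF eps]]
      by (elim exE conjE)
    obtain d2 where d2: "d2 > 0" "\<forall>y. dist y x < d2 \<longrightarrow> dist (?B y) (?B x) < \<epsilon>/2"
      using cont(2)[unfolded continuous_at_eps_delta, rule_format, OF half_gt_zero[OF eps]]
      by (elim exE conjE)
    define d where "d = min e (min d1 d2)"
    \<comment> \<open>This size keeps the parallelogram with sides \<open>t u\<close> and
      \<open>t v\<close> within \<open>d / 2\<close> of \<open>x\<close>; the summand 1 avoids a
      zero denominator when \<open>u\<close> and \<open>v\<close> both vanish.\<close>
    define t where "t = d / (2 * (norm u + norm v + 1))"
    have pos: "norm u + norm v + 1 > 0" by (simp add: add_nonneg_pos)
    have d: "d > 0" using e d1 d2 by (simp add: d_def)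
    then have t: "t > 0" using pos by (simp add: t_def)
    have near: "dist (x + a *\<^sub>R u + b *\<^sub>R v) x < d" if "0 \<le> a" "a \<le> t" "0 \<le> b" "b \<le> t" for a b
    proof -
      have "norm (a *\<^sub>R u + b *\<^sub>R v) \<le> a * norm u + b * norm v"
        using norm_triangle_ineq[of "a *\<^sub>R u" "b *\<^sub>R v"] that by simp
      also have "\<dots> \<le> t * norm u + t * norm v"
        using that by (intro add_mono mult_right_mono) auto
      also have "\<dots> \<le> t * (norm u + norm v + 1)"
        using t by (simp add: algebra_simps)
      also have "\<dots> = d / 2" using pos by (simp add: t_def field_simps)
      also have "\<dots> < d" using d by simp
      finally show ?thesis by (simp add: dist_norm add.assoc)
    qed
    have U1: "x + a *\<^sub>R u + b *\<^sub>R v \<in> U" if "0 \<le> a" "a \<le> t" "0 \<le> b" "b \<le> t" for a b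
      using near[OF that] e by (auto simp: d_def dist_commute)
    have U2: "x + a *\<^sub>R v + b *\<^sub>R u \<in> U" if "0 \<le> a" "a \<le> t" "0 \<le> b" "b \<le> t" for a b
      using U1[OF that(3,4,1,2)] by (simp add: add_ac)
    have "\<exists>a b. 0 \<le> a \<and> a \<le> t \<and> 0 \<le> b \<and> b \<le> t \<and>
        F (x + t *\<^sub>R u + t *\<^sub>R v) - F (x + t *\<^sub>R u) - F (x + t *\<^sub>R v) + F x
          = t\<^sup>2 * ?A (x + a *\<^sub>R u + b *\<^sub>R v)"
      by (rule second_difference_mean_value[where U = U]) (fact F t U1)+
    then obtain a b where ab: "0 \<le> a" "a \<le> t" "0 \<le> b" "b \<le> t" and
      1: "F (x + t *\<^sub>R u + t *\<^sub>R v) - F (x + t *\<^sub>R u) - F (x + t *\<^sub>R v) + F x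
        = t\<^sup>2 * ?A (x + a *\<^sub>R u + b *\<^sub>R v)"
      by (elim exE conjE)
    have "\<exists>a b. 0 \<le> a \<and> a \<le> t \<and> 0 \<le> b \<and> b \<le> t \<and>
        F (x + t *\<^sub>R v + t *\<^sub>R u) - F (x + t *\<^sub>R v) - F (x + t *\<^sub>R u) + F x
          = t\<^sup>2 * ?B (x + a *\<^sub>R v + b *\<^sub>R u)"
      by (rule second_difference_mean_value[where U = U]) (fact F t U2)+
    then obtain a' b' where ab': "0 \<le> a'" "a' \<le> t" "0 \<le> b'" "b' \<le> t" and
      2: "F (x + t *\<^sub>R v + t *\<^sub>R u) - F (x + t *\<^sub>R v) - F (x + t *\<^sub>R u) + F x
        = t\<^sup>2 * ?B (x + a' *\<^sub>R v + b' *\<^sub>R u)"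
      by (elim exE conjE)
    have "x + t *\<^sub>R v + t *\<^sub>R u = x + t *\<^sub>R u + t *\<^sub>R v"
      by (simp add: add_ac)
    then have "F (x + t *\<^sub>R v + t *\<^sub>R u) = F (x + t *\<^sub>R u + t *\<^sub>R v)"
      by (rule arg_cong)
    then have "t\<^sup>2 * ?A (x + a *\<^sub>R u + b *\<^sub>R v) = t\<^sup>2 * ?B (x + a' *\<^sub>R v + b' *\<^sub>R u)"
      using 1 2 by linarith
    \<comment> \<open>The two mixed derivatives share a value, taken at two points near
      \<open>x\<close>. By continuity each is within \<open>\<epsilon>/2\<close> of its own value at
      \<open>x\<close>, which bounds the gap between those values.\<close>
    then have eq: "?A (x + a *\<^sub>R u + b *\<^sub>R v) = ?B (x + a' *\<^sub>R v + b' *\<^sub>R u)"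
      using t by simp
    have "dist (?A (x + a *\<^sub>R u + b *\<^sub>R v)) (?A x) < \<epsilon>/2"
      using near[OF ab] by (intro d1(2)[rule_format]) (simp add: d_def)
    moreover have "dist (?B (x + a' *\<^sub>R v + b' *\<^sub>R u)) (?B x) < \<epsilon>/2"
      using near[OF ab'(3,4,1,2)] by (intro d2(2)[rule_format]) (simp add: d_def add_ac)
    ultimately show ?thesis
      unfolding eq
      using dist_triangle3[of "?A x" "?B x" "?B (x + a' *\<^sub>R v + b' *\<^sub>R u)"] by linarith
  qed
  then show ?thesis
    using field_le_epsilon[of "dist (?A x) (?B x)" 0] by simp
qed

section \<open>Real-analytic functions\<close>

lemma has_sum_sum:
  fixes f :: "'i \<Rightarrow> 'a \<Rightarrow> 'b::real_normed_vector"
  assumes "\<And>i. i \<in> I \<Longrightarrow> (f i has_sum s i) A"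
  shows "((\<lambda>x. \<Sum>i\<in>I. f i x) has_sum (\<Sum>i\<in>I. s i)) A"
  using assms by (induction I rule: infinite_finite_induct) (simp_all add: has_sum_add)

text \<open>Real unordered sums converge absolutely, and the norm is at most the sum of the absolute
  coordinates. Analyticity provides only \<open>has_sum\<close>, whereas the majorant of the
  differentiated series needs norms.\<close>

lemma summable_on_euclidean_imp_abs_summable_on:
  fixes f :: "'a \<Rightarrow> 'b::euclidean_space"
  assumes "f summable_on A"
  shows "(\<lambda>x. norm (f x)) summable_on A"
proof -
  have "(\<lambda>x. \<bar>f x \<bullet> b\<bar>) summable_on A" for b
    using summable_on_bounded_linear[OF bounded_linear_inner_left assms, of b]
      summable_on_iff_abs_summable_on_real[where f = "\<lambda>x. f x \<bullet> b" and A = A] by simp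
  then have "((\<lambda>x. \<Sum>b\<in>Basis. \<bar>f x \<bullet> b\<bar>) has_sum (\<Sum>b\<in>Basis. \<Sum>\<^sub>\<infinity>x\<in>A. \<bar>f x \<bullet> b\<bar>)) A"
    by (intro has_sum_sum has_sum_infsum)
  then have "(\<lambda>x. \<Sum>b\<in>Basis. \<bar>f x \<bullet> b\<bar>) summable_on A"
    by (rule has_sum_imp_summable)
  then have "(\<lambda>x. norm (\<Sum>b\<in>Basis. \<bar>f x \<bullet> b\<bar>)) summable_on A"
    by (rule iffD1[OF summable_on_iff_abs_summable_on_real])
  then show ?thesis
  proof (rule Infinite_Sum.abs_summable_on_comparison_test)
    show "norm (f x) \<le> norm (\<Sum>b\<in>Basis. \<bar>f x \<bullet> b\<bar>)" for x
      unfolding real_norm_def by (rule order_trans[OF norm_le_l1 abs_ge_self])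
  qed
qed

section \<open>Monomials and termwise differentiation of multivariate power series\<close>

definition monomial_at :: "('a::euclidean_space \<Rightarrow> nat) \<Rightarrow> 'a \<Rightarrow> real"
  where "monomial_at \<alpha> z = (\<Prod>b\<in>Basis. (z \<bullet> b) ^ \<alpha> b)"

lemma monomial_at_fun_upd:
  assumes "b \<in> Basis"
  shows "monomial_at (\<alpha>(b := k)) z = (z \<bullet> b) ^ k * (\<Prod>j\<in>Basis - {b}. (z \<bullet> j) ^ \<alpha> j)"
  unfolding monomial_at_def by (subst prod.remove[OF _ assms]) auto

text \<open>The truncated exponent \<open>\<alpha> b - 1\<close> is harmless: when
  \<open>\<alpha> b = 0\<close> the factor \<open>\<alpha> b\<close> removes the term.\<close>

lemma has_derivative_monomial_at:
  "((\<lambda>y. monomial_at \<alpha> (y - x)) has_derivative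
     (\<lambda>h. \<Sum>b\<in>Basis. (h \<bullet> b) * (\<alpha> b * monomial_at (\<alpha>(b := \<alpha> b - 1)) (y - x)))) (at y within S)"
proof -
  have "((\<lambda>y. \<Prod>b\<in>Basis. ((y - x) \<bullet> b) ^ \<alpha> b) has_derivative
     (\<lambda>h. \<Sum>b\<in>Basis. (\<alpha> b * (h \<bullet> b) * ((y - x) \<bullet> b) ^ (\<alpha> b - 1))
        * (\<Prod>j\<in>Basis - {b}. ((y - x) \<bullet> j) ^ \<alpha> j))) (at y within S)"
    by (rule has_derivative_prod) (auto intro!: derivative_eq_intros simp: algebra_simps)
  moreover have "(\<lambda>h. \<Sum>b\<in>Basis. (\<alpha> b * (h \<bullet> b) * ((y - x) \<bullet> b) ^ (\<alpha> b - 1))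
        * (\<Prod>j\<in>Basis - {b}. ((y - x) \<bullet> j) ^ \<alpha> j))
     = (\<lambda>h. \<Sum>b\<in>Basis. (h \<bullet> b) * (\<alpha> b * monomial_at (\<alpha>(b := \<alpha> b - 1)) (y - x)))"
    by (intro ext sum.cong) (simp_all add: monomial_at_fun_upd)
  ultimately show ?thesis
    by (simp add: monomial_at_def)
qed

text \<open>On the half-size cube the factor \<open>\<alpha> b\<close> produced by differentiation is absorbed by the powers
  of \<open>1 / 2\<close>, so the differentiated series is dominated by the series at the corner of the full cube.\<close>

lemma abs_monomial_at_derivative_le:
  fixes z :: "'a::euclidean_space"
  assumes "r > 0" "b \<in> Basis" "\<And>j. j \<in> Basis \<Longrightarrow> \<bar>z \<bullet> j\<bar> \<le> r / 2"
  shows "\<bar>\<alpha> b * monomial_at (\<alpha>(b := \<alpha> b - 1)) z\<bar> \<le> (1 / r) * \<bar>monomial_at \<alpha> (\<Sum>j\<in>Basis. r *\<^sub>R j)\<bar>"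
proof (cases "\<alpha> b")
  case 0
  then show ?thesis using assms by simp
next
  case (Suc m)
  let ?P = "\<Prod>j\<in>Basis - {b}. \<bar>z \<bullet> j\<bar> ^ \<alpha> j"
  let ?R = "\<Prod>j\<in>Basis - {b}. r ^ \<alpha> j"
  have P: "0 \<le> ?P" "?P \<le> ?R"
  proof -
    show "?P \<le> ?R"
    proof (intro prod_mono conjI power_mono)
      show "\<bar>z \<bullet> j\<bar> \<le> r" if "j \<in> Basis - {b}" for j
        using assms(1) assms(3)[of j] that by simp
    qed auto
  qed (simp add: prod_nonneg)
  have "real (Suc m) \<le> 2 ^ m"
    by (induction m) auto
  have "\<bar>z \<bullet> b\<bar> ^ m \<le> (r / 2) ^ m"
    using assms by (intro power_mono) auto
  then have "real (Suc m) * \<bar>z \<bullet> b\<bar> ^ m \<le> 2 ^ m * (r / 2) ^ m"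
    using \<open>real (Suc m) \<le> 2 ^ m\<close> by (intro mult_mono) auto
  also have "\<dots> = r ^ m"
    by (simp add: power_divide)
  finally have "(real (Suc m) * \<bar>z \<bullet> b\<bar> ^ m) * ?P \<le> r ^ m * ?R"
    using P assms(1) by (intro mult_mono) auto
  moreover have "\<bar>\<alpha> b * monomial_at (\<alpha>(b := \<alpha> b - 1)) z\<bar> = (real (Suc m) * \<bar>z \<bullet> b\<bar> ^ m) * ?P"
    using Suc by (simp add: monomial_at_fun_upd[OF assms(2)] abs_mult power_abs abs_prod)
  \<comment> \<open>The corner has all coordinates equal to \<open>r\<close>, so its monomial
    contains \<open>r ^ Suc m\<close> from direction \<open>b\<close>; the prefactor
    \<open>1 / r\<close> cancels the power lost by differentiation.\<close>
  moreover have "(1 / r) * \<bar>monomial_at \<alpha> (\<Sum>j\<in>Basis. r *\<^sub>R j)\<bar> = r ^ m * ?R"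
  proof -
    have "monomial_at \<alpha> (\<Sum>j\<in>Basis. r *\<^sub>R j) = (\<Prod>j\<in>Basis. r ^ \<alpha> j)"
      unfolding monomial_at_def by (intro prod.cong) (auto simp: inner_sum_left_Basis)
    also have "\<dots> = r ^ Suc m * ?R"
      using Suc by (subst prod.remove[OF _ assms(2)]) auto
    moreover have "0 \<le> r ^ Suc m * ?R"
      using assms(1) by (intro mult_nonneg_nonneg prod_nonneg) auto
    ultimately show ?thesis
      using assms(1) by simp
  qed
  ultimately show ?thesis by simp
qed

text \<open>Absolute convergence at the corner of a cube inside the ball dominates all formal
  partial derivatives on a smaller ball, so they converge uniformly there and the series may be
  differentiated term by term. The shifted coefficients in the conclusion come from reindexing,
  which makes each partial derivative a power series about the same centre.\<close>

lemma power_series_termwise_derivative: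
  fixes f :: "'a::euclidean_space \<Rightarrow> 'b::euclidean_space"
  assumes e: "e > 0"
    and f: "\<forall>y\<in>ball x e.
      ((\<lambda>\<alpha>. monomial_at \<alpha> (y - x) *\<^sub>R c \<alpha>) has_sum f y) (Basis \<rightarrow>\<^sub>E (UNIV :: nat set))"
  shows "\<exists>d>0. \<exists>G. \<forall>y\<in>ball x d. (f has_derivative (\<lambda>h. \<Sum>b\<in>Basis. (h \<bullet> b) *\<^sub>R G b y)) (at y) \<and>
     (\<forall>b\<in>Basis. ((\<lambda>\<beta>. monomial_at \<beta> (y - x) *\<^sub>R (real (\<beta> b + 1) *\<^sub>R c (\<beta>(b := \<beta> b + 1))))
        has_sum G b y) (Basis \<rightarrow>\<^sub>E (UNIV :: nat set)))"
proof -
  define I where "I = (Basis :: 'a set) \<rightarrow>\<^sub>E (UNIV :: nat set)"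
  \<comment> \<open>The corner \<open>z\<close> has norm at most \<open>DIM('a)\<close> times
    \<open>r\<close>, which is \<open>e / 2\<close>, so \<open>x + z\<close> lies in the ball of
    convergence.\<close>
  define r where "r = e / (2 * real DIM('a))"
  define z where "z = (\<Sum>j\<in>(Basis :: 'a set). r *\<^sub>R j)"
  \<comment> \<open>A ball of radius \<open>r / 2\<close> lies in the half-size cube on which the
    derivative of a monomial is dominated by its value at the corner.\<close>
  define S where "S = ball x (r / 2)"
  define T where "T b \<alpha> y = (\<alpha> b * monomial_at (\<alpha>(b := \<alpha> b - 1)) (y - x)) *\<^sub>R c \<alpha>" for b \<alpha> y
  define G where "G b y = infsum (\<lambda>\<alpha>. T b \<alpha> y) I" for b y
  define K where "K \<alpha> = (1 / r) * norm (monomial_at \<alpha> z *\<^sub>R c \<alpha>)" for \<alpha>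
  have r: "r > 0" using e by (simp add: r_def)
  have "norm z \<le> (\<Sum>j\<in>(Basis :: 'a set). r)"
    unfolding z_def using r by (intro sum_norm_le) auto
  also have "\<dots> = e / 2" by (simp add: r_def)
  finally have "x + z \<in> ball x e" using e by (simp add: dist_norm)
  from bspec[OF f this] have "(\<lambda>\<alpha>. monomial_at \<alpha> z *\<^sub>R c \<alpha>) summable_on I"
    by (auto simp: I_def intro: has_sum_imp_summable)
  then have K: "K summable_on I"
    unfolding K_def by (intro summable_on_cmult_right summable_on_euclidean_imp_abs_summable_on)
  have "r / 2 < e"
  proof -
    have "r \<le> e / 2"
      using e DIM_positive[where 'a = 'a] unfolding r_def by (intro divide_left_mono) auto
    then show ?thesis using e by simp
  qed
  then have S: "S \<subseteq> ball x e" "open S" "convex S" "x \<in> S"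
    using r by (auto simp: S_def)
  have T_le: "norm (T b \<alpha> y) \<le> K \<alpha>" if "b \<in> Basis" "y \<in> S" for b \<alpha> y
  proof -
    have "\<bar>(y - x) \<bullet> j\<bar> \<le> r / 2" if "j \<in> Basis" for j
      using \<open>y \<in> S\<close> Basis_le_norm[OF that, of "y - x"] by (simp add: S_def dist_norm norm_minus_commute)
    from abs_monomial_at_derivative_le[OF r \<open>b \<in> Basis\<close> this]
    have "\<bar>\<alpha> b * monomial_at (\<alpha>(b := \<alpha> b - 1)) (y - x)\<bar> * norm (c \<alpha>)
        \<le> (1 / r) * \<bar>monomial_at \<alpha> z\<bar> * norm (c \<alpha>)"
      unfolding z_def by (intro mult_right_mono) auto
    then show ?thesis by (simp add: T_def K_def)
  qed
  have T_sum: "((\<lambda>\<alpha>. T b \<alpha> y) has_sum G b y) I" if "b \<in> Basis" "y \<in> S" for b y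
  proof -
    have "(\<lambda>\<alpha>. norm (T b \<alpha> y)) summable_on I"
    proof (rule Infinite_Sum.abs_summable_on_comparison_test)
      show "(\<lambda>\<alpha>. norm (K \<alpha>)) summable_on I"
        using K by (rule iffD1[OF summable_on_iff_abs_summable_on_real])
      show "norm (T b \<alpha> y) \<le> norm (K \<alpha>)" for \<alpha>
        using T_le[OF that, of \<alpha>] by simp
    qed
    then show ?thesis
      unfolding G_def by (rule has_sum_infsum[OF Infinite_Sum.abs_summable_summable])
  qed
  \<comment> \<open>The M-test and the differentiation theorem concern series over the naturals, so
    the multi-indices are enumerated; absolute or unordered summability makes the choice of
    enumeration immaterial.\<close>
  have "countable I"
    unfolding I_def by (intro countable_PiE) auto
  moreover have "infinite I"
    unfolding I_def by (subst finite_PiE_iff) auto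
  ultimately have "bij_betw (from_nat_into I) UNIV I"
    by (rule bij_betw_from_nat_into)
  then obtain \<phi> where \<phi>: "bij_betw \<phi> (UNIV :: nat set) I"
    by (rule that)
  have sums: "(\<lambda>n. g (\<phi> n)) sums s" if "(g has_sum s) I" for g :: "('a \<Rightarrow> nat) \<Rightarrow> 'b" and s
    using that by (intro has_sum_imp_sums) (simp add: has_sum_reindex_bij_betw[OF \<phi>])
  have unif: "uniform_limit S (\<lambda>n y. \<Sum>i<n. T b (\<phi> i) y) (G b) sequentially" if "b \<in> Basis" for b
  proof -
    have "uniform_limit S (\<lambda>n y. \<Sum>i<n. T b (\<phi> i) y) (\<lambda>y. suminf (\<lambda>i. T b (\<phi> i) y)) sequentially"
    proof (rule Weierstrass_m_test)
      show "norm (T b (\<phi> n) y) \<le> K (\<phi> n)" if "y \<in> S" for n y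
        using T_le \<open>b \<in> Basis\<close> that by blast
      show "summable (\<lambda>n. K (\<phi> n))"
        using K \<phi> by (intro summable_on_imp_summable) (simp add: summable_on_reindex_bij_betw)
    qed
    moreover have "suminf (\<lambda>i. T b (\<phi> i) y) = G b y" if "y \<in> S" for y
      using sums[OF T_sum[OF \<open>b \<in> Basis\<close> that]] by (simp add: sums_iff)
    ultimately show ?thesis
      using uniform_limit_cong'[OF refl, of S "\<lambda>y. suminf (\<lambda>i. T b (\<phi> i) y)" "G b"] by blast
  qed
  have "\<exists>g. \<forall>y\<in>S. (\<lambda>n. monomial_at (\<phi> n) (y - x) *\<^sub>R c (\<phi> n)) sums g y \<and>
      (g has_derivative (\<lambda>h. \<Sum>b\<in>Basis. (h \<bullet> b) *\<^sub>R G b y)) (at y within S)"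
  proof (rule has_derivative_series[where f' = "\<lambda>n y h. \<Sum>b\<in>Basis. (h \<bullet> b) *\<^sub>R T b (\<phi> n) y"])
    show "convex S" "x \<in> S" by fact+
    show "(\<lambda>n. monomial_at (\<phi> n) (x - x) *\<^sub>R c (\<phi> n)) sums f x"
      using bspec[OF f, of x] e by (intro sums) (simp add: I_def)
    show "((\<lambda>y. monomial_at (\<phi> n) (y - x) *\<^sub>R c (\<phi> n)) has_derivative
        (\<lambda>h. \<Sum>b\<in>Basis. (h \<bullet> b) *\<^sub>R T b (\<phi> n) y)) (at y within S)" for n y
      using has_derivative_scaleR_left[OF has_derivative_monomial_at[of "\<phi> n" x y S], of "c (\<phi> n)"]
      by (simp add: T_def scaleR_sum_left)
    fix \<epsilon> :: real assume "\<epsilon> > 0"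
    \<comment> \<open>The error is split over the \<open>DIM('a)\<close> basis directions, each
      contributing at most \<open>norm h * \<delta>\<close>.\<close>
    define \<delta> where "\<delta> = \<epsilon> / real DIM('a)"
    have "\<delta> > 0" using \<open>\<epsilon> > 0\<close> by (simp add: \<delta>_def)
    have "\<forall>\<^sub>F n in sequentially. \<forall>b\<in>Basis. \<forall>y\<in>S. dist (\<Sum>i<n. T b (\<phi> i) y) (G b y) < \<delta>"
      using uniform_limitD[OF unif \<open>\<delta> > 0\<close>] by (intro eventually_ball_finite) auto
    then show "\<forall>\<^sub>F n in sequentially. \<forall>y\<in>S. \<forall>h. norm ((\<Sum>i<n. \<Sum>b\<in>Basis. (h \<bullet> b) *\<^sub>R T b (\<phi> i) y)
        - (\<Sum>b\<in>Basis. (h \<bullet> b) *\<^sub>R G b y)) \<le> \<epsilon> * norm h"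
    proof (rule eventually_mono, intro ballI allI)
      fix n y and h :: 'a
      assume *: "\<forall>b\<in>Basis. \<forall>y\<in>S. dist (\<Sum>i<n. T b (\<phi> i) y) (G b y) < \<delta>" and "y \<in> S"
      have "(\<Sum>i<n. \<Sum>b\<in>Basis. (h \<bullet> b) *\<^sub>R T b (\<phi> i) y) - (\<Sum>b\<in>Basis. (h \<bullet> b) *\<^sub>R G b y)
          = (\<Sum>b\<in>Basis. (h \<bullet> b) *\<^sub>R ((\<Sum>i<n. T b (\<phi> i) y) - G b y))"
        by (subst sum.swap) (simp add: scaleR_sum_right sum_subtractf scaleR_diff_right)
      also have "norm \<dots> \<le> (\<Sum>b\<in>(Basis :: 'a set). norm h * \<delta>)"
      proof (rule sum_norm_le)
        fix b :: 'a assume "b \<in> Basis"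
        then have "norm ((\<Sum>i<n. T b (\<phi> i) y) - G b y) \<le> \<delta>"
          using * \<open>y \<in> S\<close> by (simp add: dist_norm less_imp_le)
        then show "norm ((h \<bullet> b) *\<^sub>R ((\<Sum>i<n. T b (\<phi> i) y) - G b y)) \<le> norm h * \<delta>"
          unfolding norm_scaleR by (intro mult_mono) (auto simp: Basis_le_norm \<open>b \<in> Basis\<close>)
      qed
      also have "\<dots> = \<epsilon> * norm h" by (simp add: \<delta>_def)
      finally show "norm ((\<Sum>i<n. \<Sum>b\<in>Basis. (h \<bullet> b) *\<^sub>R T b (\<phi> i) y)
        - (\<Sum>b\<in>Basis. (h \<bullet> b) *\<^sub>R G b y)) \<le> \<epsilon> * norm h" .
    qed
  qed
  then obtain g where g: "\<forall>y\<in>S. (\<lambda>n. monomial_at (\<phi> n) (y - x) *\<^sub>R c (\<phi> n)) sums g y \<and>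
      (g has_derivative (\<lambda>h. \<Sum>b\<in>Basis. (h \<bullet> b) *\<^sub>R G b y)) (at y within S)" ..
  \<comment> \<open>The differentiation theorem yields an anonymous limit \<open>g\<close>;
    uniqueness of sums identifies it with \<open>f\<close> on \<open>S\<close>.\<close>
  have fg: "g y = f y" if "y \<in> S" for y
    by (rule sums_unique2[OF conjunct1[OF bspec[OF g that]]
          sums[OF bspec[OF f[folded I_def] subsetD[OF S(1) that]]]])
  have "(f has_derivative (\<lambda>h. \<Sum>b\<in>Basis. (h \<bullet> b) *\<^sub>R G b y)) (at y)" if "y \<in> S" for y
  proof -
    have "(g has_derivative (\<lambda>h. \<Sum>b\<in>Basis. (h \<bullet> b) *\<^sub>R G b y)) (at y)"
      using conjunct2[OF bspec[OF g that]] by (simp only: at_within_open[OF that S(2)])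
    then show ?thesis
      by (rule has_derivative_transform_within_open[OF _ S(2) that fg])
  qed
  moreover have "((\<lambda>\<beta>. monomial_at \<beta> (y - x) *\<^sub>R (real (\<beta> b + 1) *\<^sub>R c (\<beta>(b := \<beta> b + 1)))) has_sum G b y) I"
    if "y \<in> S" "b \<in> Basis" for y b
  proof -
    \<comment> \<open>The terms with \<open>\<alpha> b = 0\<close> vanish, so the sum over
      \<open>I\<close> equals the sum over the image of \<open>s\<close>. Reindexing along
      \<open>s\<close> turns the exponent \<open>\<alpha> b - 1\<close> into
      \<open>\<beta> b\<close> and the factor \<open>\<alpha> b\<close> into
      \<open>\<beta> b + 1\<close>.\<close>
    define s where "s \<beta> = \<beta>(b := \<beta> b + 1)" for \<beta> :: "'a \<Rightarrow> nat"
    have "inj s"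
      by (rule inj_on_inverseI[where g = "\<lambda>\<alpha>. \<alpha>(b := \<alpha> b - 1)"]) (simp add: s_def)
    have im: "s ` I = {\<alpha> \<in> I. \<alpha> b > 0}"
    proof (intro subset_antisym subsetI)
      fix \<alpha> assume \<alpha>: "\<alpha> \<in> {\<alpha> \<in> I. \<alpha> b > 0}"
      then have "\<alpha> = s (\<alpha>(b := \<alpha> b - 1))" by (auto simp: s_def)
      moreover have "\<alpha>(b := \<alpha> b - 1) \<in> I"
        using \<alpha> that(2) by (auto simp: I_def PiE_iff extensional_def)
      ultimately show "\<alpha> \<in> s ` I" by blast
    qed (use that(2) in \<open>auto simp: s_def I_def PiE_iff extensional_def\<close>)
    have "((\<lambda>\<alpha>. T b \<alpha> y) has_sum G b y) (s ` I)"
      using T_sum[OF that(2,1)] unfolding im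
      by (subst has_sum_cong_neutral[where T = I and g = "\<lambda>\<alpha>. T b \<alpha> y"]) (auto simp: T_def)
    then have "((\<lambda>\<alpha>. T b \<alpha> y) \<circ> s has_sum G b y) I"
      by (rule iffD1[OF has_sum_reindex[OF inj_on_subset[OF \<open>inj s\<close> subset_UNIV]]])
    moreover have "(\<lambda>\<alpha>. T b \<alpha> y) \<circ> s
        = (\<lambda>\<beta>. monomial_at \<beta> (y - x) *\<^sub>R (real (\<beta> b + 1) *\<^sub>R c (\<beta>(b := \<beta> b + 1))))"
      by (auto simp: T_def s_def fun_eq_iff mult.commute)
    ultimately show ?thesis by simp
  qed
  ultimately show ?thesis
    using r unfolding S_def I_def by (intro exI[of _ "r / 2"] conjI exI[of _ G] ballI) simp_all
qed

section \<open>Derivatives and linear combinations of real-analytic functions\<close>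

lemma real_analytic_on_iff_monomial_at:
  "real_analytic_on f U \<longleftrightarrow>
     (\<forall>x\<in>U. \<exists>e>0. \<exists>c. \<forall>y\<in>ball x e.
       ((\<lambda>\<alpha>. monomial_at \<alpha> (y - x) *\<^sub>R c \<alpha>) has_sum f y) (Basis \<rightarrow>\<^sub>E (UNIV :: nat set)))"
  by (simp add: real_analytic_on_def monomial_at_def)

lemma real_analytic_onE:
  assumes "real_analytic_on f U" "x \<in> U"
  obtains e c where "e > 0" "\<forall>y\<in>ball x e.
    ((\<lambda>\<alpha>. monomial_at \<alpha> (y - x) *\<^sub>R c \<alpha>) has_sum f y) (Basis \<rightarrow>\<^sub>E (UNIV :: nat set))"
  using assms(1)[unfolded real_analytic_on_iff_monomial_at, rule_format, OF assms(2)]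
  by (elim exE conjE)

lemma real_analytic_onI:
  assumes "\<And>x. x \<in> U \<Longrightarrow> \<exists>e>0. \<exists>c. \<forall>y\<in>ball x e.
    ((\<lambda>\<alpha>. monomial_at \<alpha> (y - x) *\<^sub>R c \<alpha>) has_sum f y) (Basis \<rightarrow>\<^sub>E (UNIV :: nat set))"
  shows "real_analytic_on f U"
  using assms unfolding real_analytic_on_iff_monomial_at by (rule ballI)

lemma real_analytic_on_imp_differentiable:
  assumes "real_analytic_on f U" "x \<in> U"
  shows "f differentiable (at x)"
proof -
  obtain e c where "e > 0" "\<forall>y\<in>ball x e.
      ((\<lambda>\<alpha>. monomial_at \<alpha> (y - x) *\<^sub>R c \<alpha>) has_sum f y) (Basis \<rightarrow>\<^sub>E (UNIV :: nat set))"
    using assms by (rule real_analytic_onE)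
  from power_series_termwise_derivative[OF this] obtain d G where "d > 0" and
    D: "\<forall>y\<in>ball x d. (f has_derivative (\<lambda>h. \<Sum>b\<in>Basis. (h \<bullet> b) *\<^sub>R G b y)) (at y) \<and>
     (\<forall>b\<in>Basis. ((\<lambda>\<beta>. monomial_at \<beta> (y - x) *\<^sub>R (real (\<beta> b + 1) *\<^sub>R c (\<beta>(b := \<beta> b + 1))))
        has_sum G b y) (Basis \<rightarrow>\<^sub>E (UNIV :: nat set)))"
    by (elim exE conjE)
  have "x \<in> ball x d" using \<open>d > 0\<close> by simp
  from conjunct1[OF bspec[OF D this]] show ?thesis
    by (rule differentiableI)
qed

text \<open>The derivative along \<open>v\<close> combines the partial derivatives with the
  coordinates of \<open>v\<close>, and all of them have power series about \<open>x\<close> valid on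
  one common ball.\<close>

lemma real_analytic_on_directional_derivative:
  fixes f :: "'a::euclidean_space \<Rightarrow> 'b::euclidean_space"
  assumes "real_analytic_on f U"
  shows "real_analytic_on (\<lambda>x. frechet_derivative f (at x) v) U"
proof (rule real_analytic_onI)
  fix x assume "x \<in> U"
  obtain e c where "e > 0" "\<forall>y\<in>ball x e.
      ((\<lambda>\<alpha>. monomial_at \<alpha> (y - x) *\<^sub>R c \<alpha>) has_sum f y) (Basis \<rightarrow>\<^sub>E (UNIV :: nat set))"
    using assms \<open>x \<in> U\<close> by (rule real_analytic_onE)
  from power_series_termwise_derivative[OF this] obtain d G where d: "d > 0" and
    D: "\<forall>y\<in>ball x d. (f has_derivative (\<lambda>h. \<Sum>b\<in>Basis. (h \<bullet> b) *\<^sub>R G b y)) (at y) \<and>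
     (\<forall>b\<in>Basis. ((\<lambda>\<beta>. monomial_at \<beta> (y - x) *\<^sub>R (real (\<beta> b + 1) *\<^sub>R c (\<beta>(b := \<beta> b + 1))))
        has_sum G b y) (Basis \<rightarrow>\<^sub>E (UNIV :: nat set)))"
    by (elim exE conjE)
  let ?c = "\<lambda>\<beta>. \<Sum>b\<in>Basis. (v \<bullet> b) *\<^sub>R (real (\<beta> b + 1) *\<^sub>R c (\<beta>(b := \<beta> b + 1)))"
  have *: "((\<lambda>\<beta>. monomial_at \<beta> (y - x) *\<^sub>R ?c \<beta>) has_sum frechet_derivative f (at y) v)
      (Basis \<rightarrow>\<^sub>E (UNIV :: nat set))" if "y \<in> ball x d" for y
  proof -
    note Dy = conjunct1[OF bspec[OF D that]] and G = conjunct2[OF bspec[OF D that]]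
    have "frechet_derivative f (at y) v = (\<Sum>b\<in>Basis. (v \<bullet> b) *\<^sub>R G b y)"
      using fun_cong[OF frechet_derivative_at[OF Dy], of v] by simp
    moreover have "((\<lambda>\<beta>. \<Sum>b\<in>Basis. (v \<bullet> b) *\<^sub>R
        (monomial_at \<beta> (y - x) *\<^sub>R (real (\<beta> b + 1) *\<^sub>R c (\<beta>(b := \<beta> b + 1)))))
        has_sum (\<Sum>b\<in>Basis. (v \<bullet> b) *\<^sub>R G b y)) (Basis \<rightarrow>\<^sub>E (UNIV :: nat set))"
      by (intro has_sum_sum has_sum_scaleR bspec[OF G])
    moreover have "(v \<bullet> b) *\<^sub>R (m *\<^sub>R w) = m *\<^sub>R ((v \<bullet> b) *\<^sub>R w)" for b m and w :: 'b
      by (rule scaleR_left_commute)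
    ultimately show ?thesis
      by (simp only: scaleR_sum_right)
  qed
  show "\<exists>e>0. \<exists>c. \<forall>y\<in>ball x e. ((\<lambda>\<alpha>. monomial_at \<alpha> (y - x) *\<^sub>R c \<alpha>) has_sum
      frechet_derivative f (at y) v) (Basis \<rightarrow>\<^sub>E (UNIV :: nat set))"
    by (rule exI[where x = d], rule conjI[OF d], rule exI[where x = ?c], rule ballI, rule *)
qed

lemma real_analytic_on_imp_cont_diff_on:
  assumes "real_analytic_on f U"
  shows "cont_diff_on k f U"
  using assms
proof (induction k arbitrary: f)
  case 0
  then show ?case
    by (auto intro!: continuous_at_imp_continuous_on differentiable_imp_continuous_within
        real_analytic_on_imp_differentiable)
qed (simp add: real_analytic_on_imp_differentiable real_analytic_on_directional_derivative)

lemma real_analytic_on_bounded_linear: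
  assumes "bounded_linear T" "real_analytic_on f U"
  shows "real_analytic_on (\<lambda>x. T (f x)) U"
proof (rule real_analytic_onI)
  fix x assume "x \<in> U"
  obtain e c where "e > 0" and c: "\<forall>y\<in>ball x e.
      ((\<lambda>\<alpha>. monomial_at \<alpha> (y - x) *\<^sub>R c \<alpha>) has_sum f y) (Basis \<rightarrow>\<^sub>E (UNIV :: nat set))"
    using assms(2) \<open>x \<in> U\<close> by (rule real_analytic_onE)
  have *: "((\<lambda>\<alpha>. monomial_at \<alpha> (y - x) *\<^sub>R T (c \<alpha>)) has_sum T (f y)) (Basis \<rightarrow>\<^sub>E (UNIV :: nat set))"
    if "y \<in> ball x e" for y
    using has_sum_bounded_linear[OF assms(1) bspec[OF c that]]
    by (simp add: linear_cmul[OF bounded_linear.linear[OF assms(1)]])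
  show "\<exists>e>0. \<exists>c. \<forall>y\<in>ball x e. ((\<lambda>\<alpha>. monomial_at \<alpha> (y - x) *\<^sub>R c \<alpha>) has_sum
      T (f y)) (Basis \<rightarrow>\<^sub>E (UNIV :: nat set))"
    by (rule exI[where x = e], rule conjI[OF \<open>e > 0\<close>], rule exI[where x = "\<lambda>\<alpha>. T (c \<alpha>)"],
        rule ballI, rule *)
qed

lemma real_analytic_on_add:
  assumes "real_analytic_on f U" "real_analytic_on g U"
  shows "real_analytic_on (\<lambda>x. f x + g x) U"
proof (rule real_analytic_onI)
  fix x assume "x \<in> U"
  obtain e c where e: "e > 0" and c: "\<forall>y\<in>ball x e.
      ((\<lambda>\<alpha>. monomial_at \<alpha> (y - x) *\<^sub>R c \<alpha>) has_sum f y) (Basis \<rightarrow>\<^sub>E (UNIV :: nat set))"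
    using assms(1) \<open>x \<in> U\<close> by (rule real_analytic_onE)
  obtain e' c' where e': "e' > 0" and c': "\<forall>y\<in>ball x e'.
      ((\<lambda>\<alpha>. monomial_at \<alpha> (y - x) *\<^sub>R c' \<alpha>) has_sum g y) (Basis \<rightarrow>\<^sub>E (UNIV :: nat set))"
    using assms(2) \<open>x \<in> U\<close> by (rule real_analytic_onE)
  have *: "((\<lambda>\<alpha>. monomial_at \<alpha> (y - x) *\<^sub>R (c \<alpha> + c' \<alpha>)) has_sum f y + g y)
      (Basis \<rightarrow>\<^sub>E (UNIV :: nat set))" if "y \<in> ball x (min e e')" for y
  proof -
    from that have "y \<in> ball x e" "y \<in> ball x e'" by auto
    from has_sum_add[OF bspec[OF c this(1)] bspec[OF c' this(2)]] show ?thesis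
      by (simp add: scaleR_add_right)
  qed
  have pos: "min e e' > 0" using e e' by simp
  show "\<exists>e>0. \<exists>c. \<forall>y\<in>ball x e. ((\<lambda>\<alpha>. monomial_at \<alpha> (y - x) *\<^sub>R c \<alpha>) has_sum
      f y + g y) (Basis \<rightarrow>\<^sub>E (UNIV :: nat set))"
    by (rule exI[where x = "min e e'"], rule conjI[OF pos], rule exI[where x = "\<lambda>\<alpha>. c \<alpha> + c' \<alpha>"],
        rule ballI, rule *)
qed

lemma real_analytic_on_zero: "real_analytic_on (\<lambda>x. 0) U"
  by (intro real_analytic_onI exI[of _ 1] conjI exI[of _ "\<lambda>\<alpha>. 0"]) auto

section \<open>Uniform closure rules for the three kinds of regularity\<close>

lemma class_C_on_bounded_linear:
  assumes "open U" "bounded_linear T" "class_C_on s f U"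
  shows "class_C_on s (\<lambda>x. T (f x)) U"
  using assms by (cases s) (auto intro: cont_diff_on_bounded_linear real_analytic_on_bounded_linear)

lemma class_C_on_add:
  assumes "open U" "class_C_on s f U" "class_C_on s g U"
  shows "class_C_on s (\<lambda>x. f x + g x) U"
  using assms by (cases s) (auto intro: cont_diff_on_add real_analytic_on_add)

lemma class_C_on_zero: "class_C_on s (\<lambda>x. 0) U"
  by (cases s) (auto intro: cont_diff_on_zero real_analytic_on_zero)

lemma class_C_on_sum:
  assumes "open U" "\<And>i. i \<in> I \<Longrightarrow> class_C_on s (f i) U"
  shows "class_C_on s (\<lambda>x. \<Sum>i\<in>I. f i x) U"
  using assms(2)
  by (induction I rule: infinite_finite_induct) (auto intro: class_C_on_zero class_C_on_add[OF assms(1)])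

text \<open>The order hypothesis excludes \<open>Finite_Order 0\<close>, which
  \<open>pred_regularity\<close> fixes because \<open>0 - 1 = 0\<close> on naturals.\<close>

lemma class_C_on_directional_derivative:
  assumes "at_least_order 1 s" "class_C_on s f U"
  shows "class_C_on (pred_regularity s) (\<lambda>x. frechet_derivative f (at x) v) U"
proof (cases s)
  case (Finite_Order k)
  then show ?thesis using assms by (cases k) auto
next
  case Infinite_Order
  then have "cont_diff_on (Suc k) f U" for k
    using assms(2) by (simp only: class_C_on.simps)
  then show ?thesis
    unfolding Infinite_Order class_C_on.simps pred_regularity.simps by simp
next
  case Real_Analytic
  then show ?thesis using assms by (simp add: real_analytic_on_directional_derivative)
qed

lemma class_C_on_pred_regularity:
  assumes "class_C_on s f U"
  shows "class_C_on (pred_regularity s) f U"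
  using assms by (cases s) (auto intro: cont_diff_on_mono)

lemma class_C_on_imp_cont_diff_on:
  assumes "at_least_order k s" "class_C_on s f U"
  shows "cont_diff_on k f U"
  using assms by (cases s) (auto intro: cont_diff_on_mono real_analytic_on_imp_cont_diff_on)

lemma at_least_order_mono: "\<lbrakk>at_least_order k s; m \<le> k\<rbrakk> \<Longrightarrow> at_least_order m s"
  by (cases s) auto

section \<open>Integral curves\<close>

text \<open>\<open>cont_diff_on\<close> gives continuity of each directional derivative separately,
  so the operator norm is bounded by adding up the maxima along the basis vectors. Convexity then
  permits the mean value inequality.\<close>

lemma cont_diff_on_1_lipschitz_on_compact_convex:
  fixes X :: "'a::euclidean_space \<Rightarrow> 'b::real_normed_vector"
  assumes "cont_diff_on 1 X U" "compact S" "convex S" "S \<subseteq> U"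
  shows "\<exists>L\<ge>0. \<forall>x\<in>S. \<forall>y\<in>S. norm (X x - X y) \<le> L * norm (x - y)"
proof -
  let ?D = "\<lambda>x. frechet_derivative X (at x)"
  have D: "(X has_derivative ?D x) (at x)" if "x \<in> S" for x
    using assms that by (intro has_derivative_frechet_derivative) auto
  have "\<exists>B. \<forall>x\<in>S. norm (?D x b) \<le> B" for b
  proof -
    have "continuous_on S (\<lambda>x. ?D x b)"
      using assms(1) by (intro continuous_on_subset[OF _ assms(4)]) simp
    then have "bounded ((\<lambda>x. ?D x b) ` S)"
      using assms(2) compact_continuous_image compact_imp_bounded by blast
    then show ?thesis by (auto simp: bounded_iff)
  qed
  then obtain B where B: "\<forall>b. \<forall>x\<in>S. norm (?D x b) \<le> B b"
    using choice[of "\<lambda>b B. \<forall>x\<in>S. norm (?D x b) \<le> B"] by auto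
  define L where "L = (\<Sum>b\<in>(Basis :: 'a set). \<bar>B b\<bar>)"
  have on: "onorm (?D x) \<le> L" if "x \<in> S" for x
  proof (rule onorm_le)
    fix v
    have lin: "linear (?D x)" using D[OF that] has_derivative_linear by blast
    have "?D x v = ?D x (\<Sum>b\<in>Basis. (v \<bullet> b) *\<^sub>R b)"
      by (simp add: euclidean_representation)
    also have "\<dots> = (\<Sum>b\<in>Basis. (v \<bullet> b) *\<^sub>R ?D x b)"
      by (simp add: linear_sum[OF lin] linear_cmul[OF lin])
    also have "norm \<dots> \<le> (\<Sum>b\<in>Basis. norm v * \<bar>B b\<bar>)"
    proof (rule sum_norm_le)
      fix b :: 'a assume "b \<in> Basis"
      have "norm (?D x b) \<le> \<bar>B b\<bar>"
        using B that by (meson abs_ge_self order_trans)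
      then show "norm ((v \<bullet> b) *\<^sub>R ?D x b) \<le> norm v * \<bar>B b\<bar>"
        using Basis_le_norm[OF \<open>b \<in> Basis\<close>, of v] by (simp add: mult_mono)
    qed
    finally show "norm (?D x v) \<le> L * norm v"
      by (simp add: L_def sum_distrib_left mult.commute)
  qed
  have "\<forall>x\<in>S. \<forall>y\<in>S. norm (X x - X y) \<le> L * norm (x - y)"
  proof (intro ballI)
    fix x y assume xy: "x \<in> S" "y \<in> S"
    show "norm (X x - X y) \<le> L * norm (x - y)"
      by (rule differentiable_bound[OF assms(3) has_derivative_at_withinI[OF D] on xy])
  qed
  moreover have "L \<ge> 0" by (simp add: L_def sum_nonneg)
  ultimately show ?thesis by blast
qed

text \<open>Gronwall: \<open>exp (-2 L u) \<bar>g u - d u\<bar>\<^sup>2\<close> is nonincreasing.\<close>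

lemma integral_curve_unique_unit_interval:
  fixes g d :: "real \<Rightarrow> 'a::real_inner"
  assumes g: "\<And>u. u \<in> {0..1} \<Longrightarrow> (g has_vector_derivative Y (g u)) (at u within {0..1})"
    and d: "\<And>u. u \<in> {0..1} \<Longrightarrow> (d has_vector_derivative Y (d u)) (at u within {0..1})"
    and L: "\<And>u. u \<in> {0..1} \<Longrightarrow> norm (Y (g u) - Y (d u)) \<le> L * norm (g u - d u)"
    and "g 0 = d 0"
  shows "g 1 = d 1"
proof -
  define w where "w u = g u - d u" for u
  define W where "W u = Y (g u) - Y (d u)" for u
  define k where "k u = exp (- (2 * L) * u) * (w u \<bullet> w u)" for u :: real
  define k' where "k' u = exp (- (2 * L) * u) * (2 * (w u \<bullet> W u) - 2 * L * (w u \<bullet> w u))" for u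
  have w: "(w has_derivative (\<lambda>s. s *\<^sub>R W u)) (at u within {0..1})" if "u \<in> {0..1}" for u
    using has_vector_derivative_diff[OF g[OF that] d[OF that]]
    by (simp add: w_def[abs_def] W_def has_vector_derivative_def)
  have k: "(k has_derivative (\<lambda>s. s * k' u)) (at u within {0..1})" if "u \<in> {0..1}" for u
  proof -
    note [derivative_intros] = w[OF that]
    show ?thesis
      unfolding k_def[abs_def] k'_def
      by (auto intro!: derivative_eq_intros simp: algebra_simps inner_commute)
  qed
  \<comment> \<open>The sign of \<open>k'\<close> at this single point suffices, because
    \<open>k 0 = 0\<close> and only \<open>k 1\<close> is wanted.\<close>
  obtain u where u: "u \<in> {0<..<1}" "k 1 - k 0 = (1 - 0) * k' u"
    using mvt_simple[of 0 1 k "\<lambda>u s. s * k' u"] k by auto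
  have "w u \<bullet> W u \<le> norm (w u) * norm (W u)"
    by (rule norm_cauchy_schwarz)
  also have "\<dots> \<le> norm (w u) * (L * norm (w u))"
    using L[of u] u(1) by (intro mult_left_mono) (auto simp: w_def W_def)
  also have "\<dots> = L * (w u \<bullet> w u)"
    by (simp add: dot_square_norm power2_eq_square)
  finally have "k' u \<le> 0"
    unfolding k'_def by (intro mult_nonneg_nonpos) auto
  then have "k 1 \<le> 0"
    using u(2) assms(4) by (simp add: k_def w_def)
  then have "w 1 \<bullet> w 1 \<le> 0"
    by (simp add: k_def mult_le_0_iff)
  then have "w 1 = 0"
    by (metis inner_ge_zero inner_eq_zero_iff order_antisym)
  then show ?thesis
    by (simp add: w_def)
qed

text \<open>Covers positive, negative and zero \<open>t\<close> at once, so that time can be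
  rescaled to the unit interval without cases.\<close>

lemma closed_segment_zero_eq: "closed_segment 0 (t::real) = (\<lambda>u. t * u) ` {0..1}"
  by (auto simp: closed_segment_def)

text \<open>Both curves are compact, hence lie in one closed ball, on which \<open>X\<close> has a
  Lipschitz constant \<open>L\<close>. After rescaling time they are integral curves of
  \<open>t X\<close> on the unit interval, with constant \<open>\<bar>t\<bar> * L\<close>. The sets
  \<open>U\<close> and \<open>V\<close> may differ since \<open>X\<close> is C^1 everywhere.\<close>

lemma local_flow_unique:
  fixes X :: "'a::euclidean_space \<Rightarrow> 'a"
  assumes X: "cont_diff_on 1 X UNIV" and "local_flow X U t x y" "local_flow X V t x z"
  shows "y = z"
proof -
  let ?S = "closed_segment 0 t"
  obtain \<gamma> where \<gamma>: "\<gamma> 0 = x" "\<gamma> t = y"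
    "\<And>s. s \<in> ?S \<Longrightarrow> (\<gamma> has_vector_derivative X (\<gamma> s)) (at s within ?S)"
    using assms(2) unfolding local_flow_def by blast
  obtain \<delta> where \<delta>: "\<delta> 0 = x" "\<delta> t = z"
    "\<And>s. s \<in> ?S \<Longrightarrow> (\<delta> has_vector_derivative X (\<delta> s)) (at s within ?S)"
    using assms(3) unfolding local_flow_def by blast
  have rescale: "((\<lambda>u. \<eta> (t * u)) has_vector_derivative t *\<^sub>R X (\<eta> (t * u))) (at u within {0..1})"
    if \<eta>: "\<And>s. s \<in> ?S \<Longrightarrow> (\<eta> has_vector_derivative X (\<eta> s)) (at s within ?S)" and "u \<in> {0..1}"
    for \<eta> and u :: real
  proof -
    have "((*) t has_vector_derivative t) (at u within {0..1})"
      by (auto intro!: derivative_eq_intros simp: has_vector_derivative_def)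
    moreover have "(\<eta> has_vector_derivative X (\<eta> (t * u))) (at (t * u) within (*) t ` {0..1})"
      using \<eta>[of "t * u"] \<open>u \<in> {0..1}\<close> unfolding closed_segment_zero_eq by blast
    ultimately show ?thesis
      using vector_diff_chain_within by (fastforce simp: o_def)
  qed
  have bdd: "bounded (\<eta> ` ?S)"
    if "\<And>s. s \<in> ?S \<Longrightarrow> (\<eta> has_vector_derivative X (\<eta> s)) (at s within ?S)" for \<eta>
    using that
    by (intro compact_imp_bounded compact_continuous_image)
      (auto intro!: has_vector_derivative_continuous simp: continuous_on_eq_continuous_within)
  have "bounded (\<gamma> ` ?S \<union> \<delta> ` ?S)"
    using bdd[OF \<gamma>(3)] bdd[OF \<delta>(3)] by simp
  then obtain R where R: "\<gamma> ` ?S \<union> \<delta> ` ?S \<subseteq> cball 0 R"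
    unfolding bounded_iff by (metis mem_cball_0 subsetI)
  obtain L where L: "L \<ge> 0" "\<forall>x\<in>cball 0 R. \<forall>y\<in>cball 0 R. norm (X x - X y) \<le> L * norm (x - y)"
    using cont_diff_on_1_lipschitz_on_compact_convex[OF X compact_cball convex_cball subset_UNIV] by blast
  have "(\<lambda>u. \<gamma> (t * u)) 1 = (\<lambda>u. \<delta> (t * u)) 1"
  proof (rule integral_curve_unique_unit_interval[where Y = "\<lambda>x. t *\<^sub>R X x" and L = "\<bar>t\<bar> * L"])
    fix u :: real assume u: "u \<in> {0..1}"
    show "((\<lambda>u. \<gamma> (t * u)) has_vector_derivative t *\<^sub>R X (\<gamma> (t * u))) (at u within {0..1})"
      by (rule rescale[OF \<gamma>(3) u])
    show "((\<lambda>u. \<delta> (t * u)) has_vector_derivative t *\<^sub>R X (\<delta> (t * u))) (at u within {0..1})"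
      by (rule rescale[OF \<delta>(3) u])
    have "t * u \<in> ?S" using u by (auto simp: closed_segment_zero_eq)
    then have "\<gamma> (t * u) \<in> cball 0 R" "\<delta> (t * u) \<in> cball 0 R" using R by blast+
    then have "norm (X (\<gamma> (t * u)) - X (\<delta> (t * u))) \<le> L * norm (\<gamma> (t * u) - \<delta> (t * u))"
      using L(2) by blast
    then have "\<bar>t\<bar> * norm (X (\<gamma> (t * u)) - X (\<delta> (t * u))) \<le> \<bar>t\<bar> * (L * norm (\<gamma> (t * u) - \<delta> (t * u)))"
      by (rule mult_left_mono) simp
    then show "norm (t *\<^sub>R X (\<gamma> (t * u)) - t *\<^sub>R X (\<delta> (t * u))) \<le> \<bar>t\<bar> * L * norm (\<gamma> (t * u) - \<delta> (t * u))"
      by (simp flip: scaleR_diff_right)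
  qed (simp add: \<gamma> \<delta>)
  then show ?thesis
    using \<gamma> \<delta> by simp
qed

text \<open>Chain rule along the curve. The conclusion has \<open>UNIV\<close> because
  \<open>f\<close> need not map \<open>U\<close> into itself.\<close>

lemma local_flow_image:
  assumes "\<And>x. f differentiable at x" "\<And>x. frechet_derivative f (at x) (X x) = Y (f x)"
    and "local_flow X U t x y"
  shows "local_flow Y UNIV t (f x) (f y)"
proof -
  let ?S = "closed_segment 0 t"
  obtain \<gamma> where \<gamma>: "\<gamma> 0 = x" "\<gamma> t = y"
    "\<And>s. s \<in> ?S \<Longrightarrow> (\<gamma> has_vector_derivative X (\<gamma> s)) (at s within ?S)"
    using assms(3) unfolding local_flow_def by blast
  have "((\<lambda>s. f (\<gamma> s)) has_vector_derivative Y (f (\<gamma> s))) (at s within ?S)" if "s \<in> ?S" for s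
  proof -
    have "((\<lambda>s. f (\<gamma> s)) has_derivative (\<lambda>h. frechet_derivative f (at (\<gamma> s)) (h *\<^sub>R X (\<gamma> s)))) (at s within ?S)"
      using \<gamma>(3)[OF that] unfolding has_vector_derivative_def
      by (rule has_derivative_compose) (rule has_derivative_frechet_derivative[OF assms(1)])
    then show ?thesis
      by (simp add: has_vector_derivative_def assms(2) linear_cmul[OF linear_frechet_derivative[OF assms(1)]])
  qed
  then show ?thesis
    unfolding local_flow_def using \<gamma>(1,2) by (intro exI[of _ "\<lambda>s. f (\<gamma> s)"]) auto
qed

section \<open>Hamiltonian vector fields\<close>

lemma Omega_eq_inner: "Omega u v = snd u \<bullet> fst v - fst u \<bullet> snd v"
  by (simp add: Omega_def inner_vec_def sum_subtractf)

lemma Omega_commute: "Omega u v = - Omega v u"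
  by (simp add: Omega_eq_inner inner_commute)

lemma Omega_diff_left: "Omega (u - u') v = Omega u v - Omega u' v"
  by (simp add: Omega_eq_inner inner_diff_left)

text \<open>Testing \<open>u\<close> against its rotation \<open>(snd u, - fst u)\<close> gives the
  squared norm of \<open>u\<close>.\<close>

lemma Omega_nondegenerate:
  assumes "\<And>v. Omega u v = 0"
  shows "u = 0"
proof -
  have "fst u \<bullet> fst u + snd u \<bullet> snd u = 0"
    using assms[of "(snd u, - fst u)"] by (simp add: Omega_eq_inner)
  then have "u \<bullet> u = 0" by (simp add: inner_prod_def)
  then show ?thesis by simp
qed

lemma has_derivative_Omega:
  assumes "(A has_derivative A') (at x)" "(B has_derivative B') (at x)"
  shows "((\<lambda>y. Omega (A y) (B y)) has_derivative (\<lambda>h. Omega (A x) (B' h) + Omega (A' h) (B x))) (at x)"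
  unfolding Omega_eq_inner
  by (auto intro!: derivative_eq_intros assms)

lemma linear_phase_space_expansion:
  fixes L :: "(real^'n) \<times> (real^'n) \<Rightarrow> real"
  assumes "linear L"
  shows "L v = (\<Sum>i\<in>UNIV. fst v $ i * L (axis i 1, 0) + snd v $ i * L (0, axis i 1))"
proof -
  have "v = (\<Sum>i\<in>UNIV. (fst v $ i) *\<^sub>R (axis i 1, 0) + (snd v $ i) *\<^sub>R (0, axis i 1))"
    by (simp add: prod_eq_iff fst_sum snd_sum basis_expansion flip: scalar_mult_eq_scaleR)
  then have "L v = L (\<Sum>i\<in>UNIV. (fst v $ i) *\<^sub>R (axis i 1, 0) + (snd v $ i) *\<^sub>R (0, axis i 1))"
    by (rule arg_cong)
  then show ?thesis
    by (simp add: linear_sum[OF assms] linear_add[OF assms] linear_cmul[OF assms]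
        del: scaleR_Pair)
qed

text \<open>The representative of \<open>L\<close> with respect to \<open>Omega\<close>. For
  \<open>L = DF\<close> it is \<open>(- D\<^sub>p F, D\<^sub>q F)\<close>, opposite to the frequent
  convention; the sign is dictated by the form being the sum of the \<open>dp \<and> dq\<close> and
  by placing the field in the first slot. Taking a functional as argument makes the construction
  linear on the dual space.\<close>

definition symp_grad :: "((real^'n) \<times> (real^'n) \<Rightarrow> real) \<Rightarrow> (real^'n) \<times> (real^'n)"
  where "symp_grad L = ((\<chi> i. - L (0, axis i 1)), (\<chi> i. L (axis i 1, 0)))"

lemma Omega_symp_grad:
  assumes "linear L"
  shows "Omega (symp_grad L) v = L v"
  by (subst linear_phase_space_expansion[OF assms])
    (simp add: Omega_def symp_grad_def mult.commute)

text \<open>Written as scalar values of \<open>L\<close> times constant vectors, the field inherits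
  its regularity from the partial derivatives through the closure rules for sums and bounded linear
  maps.\<close>

lemma symp_grad_eq_sum:
  "symp_grad L = (\<Sum>i\<in>UNIV. L (0, axis i 1) *\<^sub>R (- axis i 1, 0) + L (axis i 1, 0) *\<^sub>R (0, axis i 1))"
proof -
  have "(\<Sum>i\<in>UNIV. c i *\<^sub>R axis i 1) = (\<chi> i. c i)" for c :: "'a \<Rightarrow> real"
    using basis_expansion[of "\<chi> i. c i"] by (simp add: scalar_mult_eq_scaleR)
  from this[of "\<lambda>i. - L (0, axis i 1)"] this[of "\<lambda>i. L (axis i 1, 0)"]
  show ?thesis
    by (simp add: symp_grad_def prod_eq_iff fst_sum snd_sum)
qed

definition hamiltonian_field ::
  "((real^'n) \<times> (real^'n) \<Rightarrow> real) \<Rightarrow> (real^'n) \<times> (real^'n) \<Rightarrow> (real^'n) \<times> (real^'n)"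
  where "hamiltonian_field F x = symp_grad (frechet_derivative F (at x))"

lemma Omega_hamiltonian_field:
  "F differentiable at x \<Longrightarrow> Omega (hamiltonian_field F x) v = frechet_derivative F (at x) v"
  by (simp add: hamiltonian_field_def Omega_symp_grad linear_frechet_derivative)

lemma frechet_derivative_hamiltonian_field:
  assumes "G differentiable at x"
  shows "frechet_derivative G (at x) (hamiltonian_field F x) = poisson_bracket F G x"
  by (subst linear_phase_space_expansion[OF linear_frechet_derivative[OF assms]])
    (simp add: hamiltonian_field_def symp_grad_def poisson_bracket_def)

lemma class_C_on_hamiltonian_field:
  assumes "at_least_order 1 s" "open U" "class_C_on s F U"
  shows "class_C_on (pred_regularity s) (hamiltonian_field F) U"
proof -
  have "class_C_on (pred_regularity s) (\<lambda>x. frechet_derivative F (at x) v *\<^sub>R w) U" for v w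
    using class_C_on_bounded_linear[OF assms(2) bounded_linear_scaleR_left
        class_C_on_directional_derivative[OF assms(1,3)]] .
  then show ?thesis
    unfolding hamiltonian_field_def[abs_def] symp_grad_eq_sum
    by (intro class_C_on_sum class_C_on_add assms(2))
qed

text \<open>With \<open>X\<close>, \<open>Y\<close> the fields of \<open>F\<close>,
  \<open>G\<close>, the expression \<open>Omega (DX h) v\<close> is the second derivative of
  \<open>F\<close>, hence symmetric in \<open>h\<close> and \<open>v\<close>, and likewise for
  \<open>Y\<close> and \<open>G\<close>. Differentiating \<open>Omega Y X = 0\<close> along
  \<open>w\<close> gives \<open>Omega Y (DX w) + Omega (DY w) X = 0\<close>; the symmetry moves
  \<open>w\<close> to the second slot and turns this into
  \<open>Omega (DY X - DX Y) w = 0\<close>.\<close>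

lemma lie_bracket_hamiltonian_field:
  fixes F G :: "(real^'n) \<times> (real^'n) \<Rightarrow> real"
  assumes F: "cont_diff_on 2 F UNIV" and G: "cont_diff_on 2 G UNIV"
    and bracket: "\<And>x. poisson_bracket F G x = 0"
  shows "lie_bracket (hamiltonian_field F) (hamiltonian_field G) x = 0"
proof (rule Omega_nondegenerate)
  fix w
  let ?X = "hamiltonian_field F" and ?Y = "hamiltonian_field G"
  let ?DX = "frechet_derivative ?X (at x)" and ?DY = "frechet_derivative ?Y (at x)"
  have diff: "H differentiable at y" "hamiltonian_field H differentiable at y"
    and second: "Omega (frechet_derivative (hamiltonian_field H) (at y) h) v
      = frechet_derivative (\<lambda>z. frechet_derivative H (at z) v) (at y) h"
    if H: "cont_diff_on 2 H UNIV" for H :: "(real^'n) \<times> (real^'n) \<Rightarrow> real" and y h v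
  proof -
    show H1: "H differentiable at y" for y
      by (rule cont_diff_on_imp_differentiable[OF H]) simp_all
    have "class_C_on (Finite_Order 1) (hamiltonian_field H) UNIV"
      using class_C_on_hamiltonian_field[of "Finite_Order 2" UNIV H] H by simp
    then show "hamiltonian_field H differentiable at y"
      by (intro cont_diff_on_imp_differentiable[where k = 1 and U = UNIV]) simp_all
    \<comment> \<open>Differentiating the defining identity of the field with \<open>v\<close> fixed
      links its derivative to the second derivative of \<open>H\<close>; the zero is the derivative
      of the constant \<open>v\<close>.\<close>
    then have "((\<lambda>z. Omega (hamiltonian_field H z) v) has_derivative
        (\<lambda>h. Omega (hamiltonian_field H y) 0
          + Omega (frechet_derivative (hamiltonian_field H) (at y) h) v)) (at y)"
      by (intro has_derivative_Omega has_derivative_frechet_derivative has_derivative_const)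
    moreover have "(\<lambda>z. Omega (hamiltonian_field H z) v) = (\<lambda>z. frechet_derivative H (at z) v)"
      by (simp add: Omega_hamiltonian_field[OF H1])
    ultimately show "Omega (frechet_derivative (hamiltonian_field H) (at y) h) v
        = frechet_derivative (\<lambda>z. frechet_derivative H (at z) v) (at y) h"
      using fun_cong[OF frechet_derivative_at, of "\<lambda>z. frechet_derivative H (at z) v" _ y h]
      by (simp add: Omega_eq_inner)
  qed
  have sym: "Omega (frechet_derivative (hamiltonian_field H) (at x) h) v
      = Omega (frechet_derivative (hamiltonian_field H) (at x) v) h"
    if "cont_diff_on 2 H UNIV" for H :: "(real^'n) \<times> (real^'n) \<Rightarrow> real" and h v
    unfolding second[OF that] by (rule second_derivative_symmetric[OF that open_UNIV UNIV_I])
  have "((\<lambda>y. Omega (?Y y) (?X y)) has_derivative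
      (\<lambda>h. Omega (?Y x) (?DX h) + Omega (?DY h) (?X x))) (at x)"
    by (intro has_derivative_Omega has_derivative_frechet_derivative diff F G)
  moreover have "Omega (?Y y) (?X y) = 0" for y
    using bracket[of y]
    by (simp only: Omega_hamiltonian_field[OF diff(1)[OF G]] frechet_derivative_hamiltonian_field[OF diff(1)[OF G]])
  ultimately have "((\<lambda>y. 0) has_derivative
      (\<lambda>h. Omega (?Y x) (?DX h) + Omega (?DY h) (?X x))) (at x)"
    by (simp only:)
  from fun_cong[OF has_derivative_unique[OF this has_derivative_const], of w]
  have "Omega (?Y x) (?DX w) + Omega (?DY w) (?X x) = 0" .
  moreover have "Omega (?DY (?X x)) w = Omega (?DY w) (?X x)" "Omega (?DX (?Y x)) w = Omega (?DX w) (?Y x)"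
    by (rule sym[OF G], rule sym[OF F])
  ultimately show "Omega (lie_bracket ?X ?Y x) w = 0"
    using Omega_commute[of "?Y x" "?DX w"] by (simp add: lie_bracket_def Omega_diff_left)
qed

lemma symplectic_hamiltonian_field:
  fixes f :: "(real^'n) \<times> (real^'n) \<Rightarrow> (real^'n) \<times> (real^'n)"
  assumes "symplectic f" "\<And>x. f differentiable at x" "\<And>x. F differentiable at x" "F \<circ> f = F"
  shows "frechet_derivative f (at x) (hamiltonian_field F x) = hamiltonian_field F (f x)"
proof -
  let ?D = "frechet_derivative f (at x)"
  have lin: "linear ?D" by (rule linear_frechet_derivative[OF assms(2)])
  have symp: "Omega (?D u) (?D v) = Omega u v" for u v
    using assms(1) unfolding symplectic_def by blast
  \<comment> \<open>A kernel vector would be \<open>Omega\<close>-orthogonal to everything. Equality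
    of dimensions then gives surjectivity, so that every test vector \<open>w\<close> below has the
    form \<open>?D v\<close> and both symplecticity and the chain rule for
    \<open>F \<circ> f = F\<close> apply to it.\<close>
  have "inj ?D"
  proof (rule linear_injective_0[THEN iffD2, OF lin], intro allI impI)
    fix u assume "?D u = 0"
    then have "Omega u v = 0" for v using symp[of u v] by (simp add: Omega_eq_inner)
    then show "u = 0" by (rule Omega_nondegenerate)
  qed
  then have "surj ?D" by (rule linear_inj_imp_surj[OF lin])
  have "?D (hamiltonian_field F x) - hamiltonian_field F (f x) = 0"
  proof (rule Omega_nondegenerate)
    fix w
    obtain v where v: "w = ?D v" using \<open>surj ?D\<close> by (rule surjE)
    have "frechet_derivative F (at x) = frechet_derivative F (at (f x)) \<circ> ?D"
      using frechet_derivative_compose[OF assms(2,3)] assms(4) by metis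
    then have "frechet_derivative F (at (f x)) w = frechet_derivative F (at x) v"
      by (simp add: v)
    then show "Omega (?D (hamiltonian_field F x) - hamiltonian_field F (f x)) w = 0"
      by (simp add: Omega_diff_left Omega_hamiltonian_field assms(3)) (simp add: v symp Omega_hamiltonian_field assms(3))
  qed
  then show ?thesis by simp
qed

lemma blinfun_apply_differential:
  "F differentiable at x \<Longrightarrow> blinfun_apply (differential F x) = frechet_derivative F (at x)"
  unfolding differential_def
  by (intro bounded_linear_Blinfun_apply has_derivative_bounded_linear[OF has_derivative_frechet_derivative])

text \<open>\<open>symp_grad\<close> is linear on the dual space and injective, since pairing with
  \<open>Omega\<close> recovers the functional; such maps preserve independence. Distinctness of the
  vectors is transported separately, as \<open>independent_family\<close> demands it besides
  independence of the image set.\<close>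

lemma independent_family_hamiltonian_field:
  fixes F :: "nat \<Rightarrow> (real^'n) \<times> (real^'n) \<Rightarrow> real"
  assumes "independent_family m (\<lambda>j. differential (F j) x)" "\<And>j. j < m \<Longrightarrow> F j differentiable at x"
  shows "independent_family m (\<lambda>j. hamiltonian_field (F j) x)"
proof -
  let ?T = "\<lambda>L :: ((real^'n) \<times> (real^'n)) \<Rightarrow>\<^sub>L real. symp_grad (blinfun_apply L)"
  have lin: "linear ?T"
    by (rule linearI) (auto simp: symp_grad_def blinfun.bilinear_simps vec_eq_iff)
  have inj: "inj ?T"
  proof (rule injI)
    fix L M :: "((real^'n) \<times> (real^'n)) \<Rightarrow>\<^sub>L real" assume "?T L = ?T M"
    then have "blinfun_apply L v = blinfun_apply M v" for v
      using Omega_symp_grad[of "blinfun_apply L" v] Omega_symp_grad[of "blinfun_apply M" v]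
      by (simp add: bounded_linear.linear blinfun.bounded_linear_right)
    then show "L = M" by (rule blinfun_eqI)
  qed
  have eq: "hamiltonian_field (F j) x = ?T (differential (F j) x)" if "j < m" for j
    using assms(2)[OF that] by (simp add: hamiltonian_field_def blinfun_apply_differential)
  have "(\<lambda>j. hamiltonian_field (F j) x) ` {..<m} = ?T ` (\<lambda>j. differential (F j) x) ` {..<m}"
    unfolding image_image by (intro image_cong refl eq) simp
  moreover have "independent (?T ` (\<lambda>j. differential (F j) x) ` {..<m})"
    by (rule linear_independent_injective_image[OF lin _ inj_on_subset[OF inj subset_UNIV]])
      (use assms(1) in \<open>simp add: independent_family_def\<close>)
  moreover have "inj_on (\<lambda>j. hamiltonian_field (F j) x) {..<m}"
  proof (rule inj_onI)
    fix i j assume ij: "i \<in> {..<m}" "j \<in> {..<m}" "hamiltonian_field (F i) x = hamiltonian_field (F j) x"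
    then have "?T (differential (F i) x) = ?T (differential (F j) x)"
      using eq by simp
    then have "differential (F i) x = differential (F j) x"
      by (rule injD[OF inj])
    then show "i = j"
      using assms(1) ij(1,2) unfolding independent_family_def by (elim conjE inj_onD)
  qed
  ultimately show ?thesis
    by (simp add: independent_family_def)
qed

section \<open>Verification of the integrability conditions\<close>

theorem proposition5p3:
  fixes f :: "(real^'n) \<times> (real^'n) \<Rightarrow> (real^'n) \<times> (real^'n)"
    and F :: "nat \<Rightarrow> (real^'n) \<times> (real^'n) \<Rightarrow> real"
    and r :: regularity
    and q p :: "real^'n"
  assumes "at_least_order 2 r"
    and "C_diffeomorphism r f"
    and "symplectic f"
    and "symplectically_integrable_with r f F"
    and "independent_family CARD('n) (\<lambda>j. differential (F j) (q, p))"
  shows "locally_integrable_near (pred_regularity r) CARD('n) f (q, p)"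
proof -
  let ?N = "CARD('n)" and ?X = "\<lambda>j. hamiltonian_field (F j)"
  \<comment> \<open>The phase space has dimension twice \<open>?N\<close>, so the required number of
    first integrals equals the number of fields.\<close>
  have dim: "DIM((real^'n) \<times> (real^'n)) - ?N = ?N" by simp
  have r1: "at_least_order 1 r" by (rule at_least_order_mono[OF assms(1)]) simp
  have F: "class_C_on r (F j) UNIV" "F j \<circ> f = F j" if "j < ?N" for j
    using assms(4) that by (auto simp: symplectically_integrable_with_def)
  have inv: "poisson_bracket (F j) (F k) x = 0" if "j < ?N" "k < ?N" for j k x
    using assms(4) that unfolding symplectically_integrable_with_def by blast
  have AE_F: "AE x in lborel. independent_family ?N (\<lambda>j. differential (F j) x)"
    using assms(4) by (auto simp: symplectically_integrable_with_def)
  have F2: "cont_diff_on 2 (F j) UNIV" if "j < ?N" for j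
    by (rule class_C_on_imp_cont_diff_on[OF assms(1) F(1)[OF that]])
  then have F_diff: "F j differentiable at x" if "j < ?N" for j x
    using that by (intro cont_diff_on_imp_differentiable[where k = 2 and U = UNIV]) simp_all
  have "cont_diff_on 1 f UNIV"
    by (rule class_C_on_imp_cont_diff_on[OF r1]) (use assms(2) in \<open>simp add: C_diffeomorphism_def\<close>)
  then have f_diff: "f differentiable at x" for x
    by (rule cont_diff_on_imp_differentiable) simp_all
  have X: "class_C_on (pred_regularity r) (?X j) UNIV" if "j < ?N" for j
    by (rule class_C_on_hamiltonian_field[OF r1 open_UNIV F(1)[OF that]])
  \<comment> \<open>Only C^2 regularity of \<open>F j\<close> is used here, which makes the field
    C^1 uniformly in all three kinds of \<open>r\<close>.\<close>
  have X1: "cont_diff_on 1 (?X j) UNIV" if "j < ?N" for j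
    using class_C_on_hamiltonian_field[of "Finite_Order 2" UNIV "F j"] F2[OF that] by simp
  have AE_X: "AE x in lborel. independent_family ?N (\<lambda>j. ?X j x)"
    using AE_F by (rule AE_mp) (intro AE_I2 impI independent_family_hamiltonian_field F_diff)
  \<comment> \<open>Both \<open>f y\<close> and \<open>z\<close> are reached from \<open>f x\<close>
    in time \<open>t\<close>: the former along the image of the given curve, the latter along the
    second given curve.\<close>
  have flow: "f y = z"
    if "j < ?N" "local_flow (?X j) UNIV t x y" "local_flow (?X j) UNIV t (f x) z" for j t x y z
  proof (rule local_flow_unique[OF X1[OF that(1)]])
    show "local_flow (?X j) UNIV t (f x) (f y)"
      by (rule local_flow_image[OF f_diff symplectic_hamiltonian_field that(2)])
        (auto intro: assms(3) f_diff F_diff F that(1))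
  qed (rule that(3))
  have "integrable_on_with (pred_regularity r) ?N f UNIV ?X F"
    unfolding integrable_on_with_def dim
  proof (intro conjI allI ballI impI)
    show "AE x in lborel. x \<in> UNIV \<longrightarrow> independent_family ?N (\<lambda>j. ?X j x)"
      "AE x in lborel. x \<in> UNIV \<longrightarrow> independent_family ?N (\<lambda>k. differential (F k) x)"
      using AE_X AE_F by simp_all
    show "lie_bracket (?X i) (?X j) x = 0" if "i < ?N" "j < ?N" for i j x
      by (rule lie_bracket_hamiltonian_field[OF F2[OF that(1)] F2[OF that(2)] inv[OF that]])
    show "blinfun_apply (differential (F k) x) (?X j x) = 0" if "k < ?N" "j < ?N" for k j x
      using inv[OF that(2,1)]
      by (simp add: blinfun_apply_differential frechet_derivative_hamiltonian_field F_diff that)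
    show "F k (f x) = F k x" if "k < ?N" for k x
      using fun_cong[OF F(2)[OF that]] by simp
  qed (auto intro: X flow class_C_on_pred_regularity F)
  moreover have "C_diffeomorphism (pred_regularity r) f"
    using assms(2) by (auto simp: C_diffeomorphism_def intro: class_C_on_pred_regularity)
  ultimately show ?thesis
    unfolding locally_integrable_near_def by (intro conjI exI[of _ UNIV] exI[of _ ?X] exI[of _ F]) auto
qed

end
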